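(* Let $\mathcal{D}=(G,\chi,a,\alpha)$ be a datum, let $n>1$ be the order of $\chi(a)$, and let $\mathcal{H}=(H_{\mathcal{D}},\cdot,\mathbin{:})$ be a Hopf $q$-brace structure on the rank one pointed Hopf algebra $H_{\mathcal{D}}$. Let $\lambda_{10},\xi_{10}\in\mathds{k}$ be the coefficients of the basis element $1=1x^0$ in $x\cdot x$ and $x\mathbin{:}x$ respectively, and for $g\in G$ let $\lambda^{xg}_{11},\xi^{xg}_{11}\in\mathds{k}$ be the coefficients of the basis element $x=1x^1$ in $x\cdot g$ and $x\mathbin{:}g$ respectively. Then the following facts hold: 1) $x\cdot x=\lambda_{10}(1-a)$ and $x\mathbin{:}x=\xi_{10}(1-a)$. 2) $a^r\cdot g=a^r\mathbin{:}g=a^r$, for all $g\in G$ and $r\in\mathbb{N}_0$. 3) $g\cdot hx^r=g\mathbin{:}hx^r=0$, for all $h,g\in G$ and $r\in\mathbb{N}$. 4) $g\cdot a^r=g\mathbin{:}a^r=g$, for all $g\in G$ and $r\in\mathbb{N}_0$. 5) $hx^r\cdot g=(\lambda^{xg}_{11})^r(h\cdot g)x^r$ and $hx^r\mathbin{:}g=(\xi^{xg}_{11})^r(h\mathbin{:}g)x^r$, for all $h,g\in G$ and $r\in\mathbb{N}$. 6) $hx^r\cdot\alpha g(a^n-1)=0$ and $hx^r\mathbin{:}\alpha g(a^n-1)=0$, for all $h,g\in G$ and $0\le r<n$.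
   Context: $\mathds{k}$ is an algebraically closed field of characteristic zero, $\mathbb{N}=\{1,2,\dots\}$, $\mathbb{N}_0=\mathbb{N}\cup\{0\}$. Sweedler notation is used. Multiplication has precedence over the binary operations $\cdot$ and $\mathbin{:}$, which have precedence over $+$ and $-$. Rank one pointed Hopf algebras. A datum $\mathcal{D}=(G,\chi,a,\alpha)$ consists of a finite group $G$, a character $\chi\colon G\to\mathds{k}^{\times}$, a central element $a\in G$ and $\alpha\in\mathds{k}$ such that, denoting by $n$ the order of $\chi(a)$, one has $n>1$ and ($\alpha(a^n-1)=0$ in $\mathds{k}[G]$ or $\chi^n=1$). $H_{\mathcal{D}}$ is the Hopf algebra generated as an algebra by $G$ and $x$, subject to the group relations of $G$, $x^n=\alpha(a^n-1)$ and $xg=\chi(g)gx$ for $g\in G$, with $\Delta(x)=x\otimes a+1\otimes x$, $\Delta(g)=g\otimes g$ (so $\epsilon(g)=1$, $\epsilon(x)=0$). It has $\mathds{k}$-basis $\{gx^m: g\in G,\ 0\le m<n\}$. Hopf $q$-braces. Let $X$ be a coalgebra and $p,d\colon X\otimes X\to X$ linear maps with $\epsilon\circ p=\epsilon\circ d=\epsilon\otimes\epsilon$; write $x\cdot y=p(x\otimes y)$, $x\mathbin{:}y=d(x\otimes y)$. $(X,\cdot,\mathbin{:})$ is a $q$-magma coalgebra if the map $X\otimes X^{\mathrm{cop}}\to X^{\mathrm{cop}}\otimes X$, $x\otimes y\mapsto y_{(1)}\mathbin{:}x_{(2)}\otimes x_{(1)}\cdot y_{(2)}$, is a coalgebra morphism;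 equivalently, $p,d\colon X\otimes X^{\mathrm{cop}}\to X$ are coalgebra maps and $v_{(1)}\mathbin{:}u_{(2)}\otimes u_{(1)}\cdot v_{(2)}=v_{(2)}\mathbin{:}u_{(1)}\otimes u_{(2)}\cdot v_{(1)}$ for all $u,v\in X$. It is left regular if $x\otimes y\mapsto x\cdot y_{(1)}\otimes y_{(2)}$ is bijective on $X\otimes X$, right regular if $x\otimes y\mapsto x\mathbin{:}y_{(2)}\otimes y_{(1)}$ is bijective, and regular if it is both. A $q$-cycle coalgebra is a left regular $q$-magma coalgebra such that for all $u,v,w$: $(u\cdot v_{(1)})\cdot(w\mathbin{:}v_{(2)})=(u\cdot w_{(2)})\cdot(v\cdot w_{(1)})$, $(u\cdot v_{(1)})\mathbin{:}(w\cdot v_{(2)})=(u\mathbin{:}w_{(2)})\cdot(v\mathbin{:}w_{(1)})$, $(u\mathbin{:}v_{(1)})\mathbin{:}(w\mathbin{:}v_{(2)})=(u\mathbin{:}w_{(2)})\mathbin{:}(v\cdot w_{(1)})$. A Hopf $q$-brace is a Hopf algebra $H$ with a regular $q$-cycle coalgebra structure $(H,\cdot,\mathbin{:})$ such that $(H,\cdot)$ and $(H,\mathbin{:})$ are right $H^{\mathrm{op}}$-modules (i.e. $h\cdot 1=h$, $h\cdot kl=(h\cdot l)\cdot k$, and likewise for $\mathbin{:}$) and, for all $h,k,l\in H$, $hk\cdot l=(h\cdot(l_{(1)}\mathbin{:}k_{(2)}))(k_{(1)}\cdot l_{(2)})$ and $hk\mathbin{:}l=(h\mathbin{:}(l_{(1)}\cdot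 k_{(2)}))(k_{(1)}\mathbin{:}l_{(2)})$. *)

theory Defs
  imports
    "HOL-Algebra.Group"
    "HOL-Library.Poly_Mapping"
    "HOL-Computational_Algebra.Polynomial"
begin

section \<open>Free algebras and their ideals\<close>

text \<open>Words form a monoid under concatenation, so that
  \<open>'s list \<Rightarrow>\<^sub>0 'k\<close> with its library ring structure is the free associative unital
  \<open>'k\<close>-algebra on the set of letters \<open>'s\<close>. The monoid is written additively because this is what
  the convolution product of \<^typ>\<open>'a \<Rightarrow>\<^sub>0 'b\<close> expects.\<close>

instantiation list :: (type) monoid_add
begin

definition zero_list :: "'a list" where "zero_list = []"

definition plus_list :: "'a list \<Rightarrow> 'a list \<Rightarrow> 'a list" where "plus_list = (@)"

instance by standard (simp_all add: zero_list_def plus_list_def)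

end

definition letter :: "'s \<Rightarrow> 's list \<Rightarrow>\<^sub>0 'k::field" where
  "letter s = Poly_Mapping.single [s] 1"

definition scalar :: "'k \<Rightarrow> 's list \<Rightarrow>\<^sub>0 'k::field" where
  "scalar c = Poly_Mapping.single [] c"

definition free_algebra :: "'s set \<Rightarrow> ('s list \<Rightarrow>\<^sub>0 'k::field) set" where
  "free_algebra S = {p. \<forall>w \<in> Poly_Mapping.keys p. set w \<subseteq> S}"

inductive_set two_sided_ideal :: "'r::ring_1 set \<Rightarrow> 'r set \<Rightarrow> 'r set"
  for A :: "'r set" and R :: "'r set" where
  zero: "0 \<in> two_sided_ideal A R"
| rel: "r \<in> R \<Longrightarrow> r \<in> two_sided_ideal A R"
| add: "r \<in> two_sided_ideal A R \<Longrightarrow> s \<in> two_sided_ideal A R \<Longrightarrow> r + s \<in> two_sided_ideal A R"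
| mult_left: "p \<in> A \<Longrightarrow> r \<in> two_sided_ideal A R \<Longrightarrow> p * r \<in> two_sided_ideal A R"
| mult_right: "p \<in> A \<Longrightarrow> r \<in> two_sided_ideal A R \<Longrightarrow> r * p \<in> two_sided_ideal A R"


section \<open>Tensors\<close>

text \<open>The tensor algebra of a vector space \<open>'h\<close> is the free algebra on the set \<open>'h\<close> modulo the
  ideal that makes letters depend linearly on vectors. Its component of degree \<open>m\<close> is the
  \<open>m\<close>-fold tensor power. A tensor is represented by a list of pure tensors, to be summed, and
  \<open>tensor_eq\<close> is equality of the represented tensors. Thus \<open>[[u\<^sub>1, u\<^sub>2]. (u\<^sub>1, u\<^sub>2) \<leftarrow> \<Delta> u]\<close> is
  Sweedler's \<open>u\<^bsub>(1)\<^esub> \<otimes> u\<^bsub>(2)\<^esub>\<close>.\<close>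

definition tensor_relations ::
    "('k::field \<Rightarrow> 'h::ab_group_add \<Rightarrow> 'h) \<Rightarrow> ('h list \<Rightarrow>\<^sub>0 'k) set" where
  "tensor_relations scale =
     {letter (u + v) - letter u - letter v | u v. True} \<union>
     {letter (scale c u) - scalar c * letter u | c u. True}"

definition tensor_eq ::
    "('k::field \<Rightarrow> 'h::ab_group_add \<Rightarrow> 'h) \<Rightarrow> 'h list list \<Rightarrow> 'h list list \<Rightarrow> bool" where
  "tensor_eq scale s t \<longleftrightarrow>
     (\<Sum>w\<leftarrow>s. Poly_Mapping.single w 1) - (\<Sum>w\<leftarrow>t. Poly_Mapping.single w 1)
       \<in> two_sided_ideal UNIV (tensor_relations scale)"

definition tensor2_eq ::
    "('k::field \<Rightarrow> 'h::ab_group_add \<Rightarrow> 'h) \<Rightarrow> ('h \<times> 'h) list \<Rightarrow> ('h \<times> 'h) list \<Rightarrow> bool" where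
  "tensor2_eq scale s t \<longleftrightarrow> tensor_eq scale [[u, v]. (u, v) \<leftarrow> s] [[u, v]. (u, v) \<leftarrow> t]"

text \<open>Bijectivity of the endomorphism of the tensor square given by \<open>u \<otimes> v \<mapsto> f u v\<close>. It is
  meaningful only if \<open>f\<close> is bilinear up to \<^const>\<open>tensor2_eq\<close>.\<close>

definition tensor2_bij ::
    "('k::field \<Rightarrow> 'h::ab_group_add \<Rightarrow> 'h) \<Rightarrow> ('h \<Rightarrow> 'h \<Rightarrow> ('h \<times> 'h) list) \<Rightarrow> bool" where
  "tensor2_bij scale f \<longleftrightarrow>
     (let F = (\<lambda>t. concat [f u v. (u, v) \<leftarrow> t]) in
      (\<forall>s t. tensor2_eq scale (F s) (F t) \<longrightarrow> tensor2_eq scale s t) \<and>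
      (\<forall>t. \<exists>s. tensor2_eq scale (F s) t))"


section \<open>Hopf algebras\<close>

locale coalgebra = vector_space scale
  for scale :: "'k::field \<Rightarrow> 'h::ab_group_add \<Rightarrow> 'h" (infixr "*s" 75) +
  fixes \<Delta> :: "'h \<Rightarrow> ('h \<times> 'h) list"
    and \<epsilon> :: "'h \<Rightarrow> 'k"
  assumes comult_add: "tensor2_eq scale (\<Delta> (u + v)) (\<Delta> u @ \<Delta> v)"
    and comult_scale: "tensor2_eq scale (\<Delta> (c *s u)) [(c *s u1, u2). (u1, u2) \<leftarrow> \<Delta> u]"
    and counit_linear: "Vector_Spaces.linear scale (*) \<epsilon>"
    and coassoc: "tensor_eq scale
          [[u11, u12, u2]. (u1, u2) \<leftarrow> \<Delta> u, (u11, u12) \<leftarrow> \<Delta> u1]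
          [[u1, u21, u22]. (u1, u2) \<leftarrow> \<Delta> u, (u21, u22) \<leftarrow> \<Delta> u2]"
    and counit_left: "(\<Sum>(u1, u2)\<leftarrow>\<Delta> u. \<epsilon> u1 *s u2) = u"
    and counit_right: "(\<Sum>(u1, u2)\<leftarrow>\<Delta> u. \<epsilon> u2 *s u1) = u"

locale hopf_algebra = coalgebra scale \<Delta> \<epsilon>
  for scale :: "'k::field \<Rightarrow> 'h::ring_1 \<Rightarrow> 'h" (infixr "*s" 75)
    and \<Delta> :: "'h \<Rightarrow> ('h \<times> 'h) list"
    and \<epsilon> :: "'h \<Rightarrow> 'k" +
  assumes scale_mult_left: "(c *s u) * v = c *s (u * v)"
    and scale_mult_right: "u * (c *s v) = c *s (u * v)"
    and comult_mult: "tensor2_eq scale (\<Delta> (u * v))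
          [(u1 * v1, u2 * v2). (u1, u2) \<leftarrow> \<Delta> u, (v1, v2) \<leftarrow> \<Delta> v]"
    and comult_one: "tensor2_eq scale (\<Delta> 1) [(1, 1)]"
    and counit_mult: "\<epsilon> (u * v) = \<epsilon> u * \<epsilon> v"
    and counit_one: "\<epsilon> 1 = 1"
    and antipode: "\<exists>S. Vector_Spaces.linear scale scale S \<and>
          (\<forall>u. (\<Sum>(u1, u2)\<leftarrow>\<Delta> u. S u1 * u2) = \<epsilon> u *s 1 \<and>
               (\<Sum>(u1, u2)\<leftarrow>\<Delta> u. u1 * S u2) = \<epsilon> u *s 1)"


section \<open>Hopf \<open>q\<close>-braces\<close>

text \<open>Linear maps on the tensor square are given as bilinear maps. The tensor
  \<open>braiding u v\<close> is \<open>v\<^bsub>(1)\<^esub> \<Colon> u\<^bsub>(2)\<^esub> \<otimes> u\<^bsub>(1)\<^esub> \<cdot> v\<^bsub>(2)\<^esub>\<close>. With \<open>C\<close> the given coalgebra, the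
  comultiplication of \<open>C \<otimes> C\<^sup>c\<^sup>o\<^sup>p\<close> sends \<open>u \<otimes> v\<close> to
  \<open>(u\<^bsub>(1)\<^esub> \<otimes> v\<^bsub>(2)\<^esub>) \<otimes> (u\<^bsub>(2)\<^esub> \<otimes> v\<^bsub>(1)\<^esub>)\<close> and the one of \<open>C\<^sup>c\<^sup>o\<^sup>p \<otimes> C\<close> sends \<open>s \<otimes> t\<close> to
  \<open>(s\<^bsub>(2)\<^esub> \<otimes> t\<^bsub>(1)\<^esub>) \<otimes> (s\<^bsub>(1)\<^esub> \<otimes> t\<^bsub>(2)\<^esub>)\<close>, so \<open>braiding_comult\<close> and \<open>braiding_counit\<close> say that
  \<open>braiding\<close> is a coalgebra morphism from \<open>C \<otimes> C\<^sup>c\<^sup>o\<^sup>p\<close> to \<open>C\<^sup>c\<^sup>o\<^sup>p \<otimes> C\<close>.\<close>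

definition braiding ::
    "('h \<Rightarrow> ('h \<times> 'h) list) \<Rightarrow> ('h \<Rightarrow> 'h \<Rightarrow> 'h) \<Rightarrow> ('h \<Rightarrow> 'h \<Rightarrow> 'h) \<Rightarrow> 'h \<Rightarrow> 'h \<Rightarrow> ('h \<times> 'h) list" where
  "braiding \<Delta> dot col u v = [(col v1 u2, dot u1 v2). (u1, u2) \<leftarrow> \<Delta> u, (v1, v2) \<leftarrow> \<Delta> v]"

locale q_magma_coalgebra = coalgebra scale \<Delta> \<epsilon>
  for scale :: "'k::field \<Rightarrow> 'h::ab_group_add \<Rightarrow> 'h" (infixr "*s" 75)
    and \<Delta> :: "'h \<Rightarrow> ('h \<times> 'h) list"
    and \<epsilon> :: "'h \<Rightarrow> 'k" +
  fixes dot :: "'h \<Rightarrow> 'h \<Rightarrow> 'h" (infixl "\<cdot>" 68)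
    and col :: "'h \<Rightarrow> 'h \<Rightarrow> 'h" (infixl "\<Colon>" 68)
  assumes dot_linear_left: "Vector_Spaces.linear scale scale (\<lambda>u. u \<cdot> v)"
    and dot_linear_right: "Vector_Spaces.linear scale scale (\<lambda>v. u \<cdot> v)"
    and col_linear_left: "Vector_Spaces.linear scale scale (\<lambda>u. u \<Colon> v)"
    and col_linear_right: "Vector_Spaces.linear scale scale (\<lambda>v. u \<Colon> v)"
    and counit_dot: "\<epsilon> (u \<cdot> v) = \<epsilon> u * \<epsilon> v"
    and counit_col: "\<epsilon> (u \<Colon> v) = \<epsilon> u * \<epsilon> v"
    and braiding_comult: "tensor_eq scale
          [[s, t, s', t']. (u1, u2) \<leftarrow> \<Delta> u, (v1, v2) \<leftarrow> \<Delta> v,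
                           (s, t) \<leftarrow> braiding \<Delta> dot col u1 v2,
                           (s', t') \<leftarrow> braiding \<Delta> dot col u2 v1]
          [[s2, t1, s1, t2]. (s, t) \<leftarrow> braiding \<Delta> dot col u v,
                             (s1, s2) \<leftarrow> \<Delta> s, (t1, t2) \<leftarrow> \<Delta> t]"
    and braiding_counit: "(\<Sum>(s, t)\<leftarrow>braiding \<Delta> dot col u v. \<epsilon> s * \<epsilon> t) = \<epsilon> u * \<epsilon> v"
begin

definition left_regular :: bool where
  "left_regular \<longleftrightarrow> tensor2_bij scale (\<lambda>u v. [(u \<cdot> v1, v2). (v1, v2) \<leftarrow> \<Delta> v])"

definition right_regular :: bool where
  "right_regular \<longleftrightarrow> tensor2_bij scale (\<lambda>u v. [(u \<Colon> v2, v1). (v1, v2) \<leftarrow> \<Delta> v])"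

end

locale q_cycle_coalgebra = q_magma_coalgebra scale \<Delta> \<epsilon> dot col
  for scale :: "'k::field \<Rightarrow> 'h::ab_group_add \<Rightarrow> 'h" (infixr "*s" 75)
    and \<Delta> :: "'h \<Rightarrow> ('h \<times> 'h) list"
    and \<epsilon> :: "'h \<Rightarrow> 'k"
    and dot :: "'h \<Rightarrow> 'h \<Rightarrow> 'h" (infixl "\<cdot>" 68)
    and col :: "'h \<Rightarrow> 'h \<Rightarrow> 'h" (infixl "\<Colon>" 68) +
  assumes left_regular: "left_regular"
    and cycle1: "(\<Sum>(v1, v2)\<leftarrow>\<Delta> v. (u \<cdot> v1) \<cdot> (w \<Colon> v2)) =
                 (\<Sum>(w1, w2)\<leftarrow>\<Delta> w. (u \<cdot> w2) \<cdot> (v \<cdot> w1))"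
    and cycle2: "(\<Sum>(v1, v2)\<leftarrow>\<Delta> v. (u \<cdot> v1) \<Colon> (w \<cdot> v2)) =
                 (\<Sum>(w1, w2)\<leftarrow>\<Delta> w. (u \<Colon> w2) \<cdot> (v \<Colon> w1))"
    and cycle3: "(\<Sum>(v1, v2)\<leftarrow>\<Delta> v. (u \<Colon> v1) \<Colon> (w \<Colon> v2)) =
                 (\<Sum>(w1, w2)\<leftarrow>\<Delta> w. (u \<Colon> w2) \<Colon> (v \<cdot> w1))"

locale hopf_q_brace = hopf_algebra scale \<Delta> \<epsilon> + q_cycle_coalgebra scale \<Delta> \<epsilon> dot col
  for scale :: "'k::field \<Rightarrow> 'h::ring_1 \<Rightarrow> 'h" (infixr "*s" 75)
    and \<Delta> :: "'h \<Rightarrow> ('h \<times> 'h) list"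
    and \<epsilon> :: "'h \<Rightarrow> 'k"
    and dot :: "'h \<Rightarrow> 'h \<Rightarrow> 'h" (infixl "\<cdot>" 68)
    and col :: "'h \<Rightarrow> 'h \<Rightarrow> 'h" (infixl "\<Colon>" 68) +
  assumes right_regular: "right_regular"
    and dot_one: "h \<cdot> 1 = h"
    and dot_mult: "h \<cdot> k * l = (h \<cdot> l) \<cdot> k"
    and col_one: "h \<Colon> 1 = h"
    and col_mult: "h \<Colon> k * l = (h \<Colon> l) \<Colon> k"
    and mult_dot: "h * k \<cdot> l =
          (\<Sum>(k1, k2)\<leftarrow>\<Delta> k. \<Sum>(l1, l2)\<leftarrow>\<Delta> l. (h \<cdot> (l1 \<Colon> k2)) * (k1 \<cdot> l2))"
    and mult_col: "h * k \<Colon> l =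
          (\<Sum>(k1, k2)\<leftarrow>\<Delta> k. \<Sum>(l1, l2)\<leftarrow>\<Delta> l. (h \<Colon> (l1 \<cdot> k2)) * (k1 \<Colon> l2))"


section \<open>Rank one pointed Hopf algebras\<close>

text \<open>Unspecified if \<open>z\<close> is not a root of unity; a character of a finite group only takes
  roots of unity as values.\<close>

definition mult_order :: "'k::field \<Rightarrow> nat" where
  "mult_order z = (LEAST m. 0 < m \<and> z ^ m = 1)"

text \<open>The group algebra of \<open>G\<close> is taken to be the free vector space \<open>'g \<Rightarrow>\<^sub>0 'k\<close>; only its
  additive structure is used. Values of \<open>\<chi>\<close> outside the carrier are irrelevant.\<close>

definition rank_one_datum ::
    "('g, 'b) monoid_scheme \<Rightarrow> ('g \<Rightarrow> 'k::field) \<Rightarrow> 'g \<Rightarrow> 'k \<Rightarrow> bool" where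
  "rank_one_datum G \<chi> a \<alpha> \<longleftrightarrow>
     group G \<and> finite (carrier G) \<and>
     (\<forall>g\<in>carrier G. \<chi> g \<noteq> 0) \<and>
     (\<forall>g\<in>carrier G. \<forall>h\<in>carrier G. \<chi> (g \<otimes>\<^bsub>G\<^esub> h) = \<chi> g * \<chi> h) \<and>
     a \<in> carrier G \<and> (\<forall>g\<in>carrier G. a \<otimes>\<^bsub>G\<^esub> g = g \<otimes>\<^bsub>G\<^esub> a) \<and>
     1 < mult_order (\<chi> a) \<and>
     (Poly_Mapping.single (a [^]\<^bsub>G\<^esub> mult_order (\<chi> a)) \<alpha> - Poly_Mapping.single \<one>\<^bsub>G\<^esub> \<alpha> = 0 \<or>
      (\<forall>g\<in>carrier G. \<chi> g ^ mult_order (\<chi> a) = 1))"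

datatype 'g gen = Grp 'g | X

definition rank_one_generators :: "('g, 'b) monoid_scheme \<Rightarrow> 'g gen set" where
  "rank_one_generators G = insert X (Grp ` carrier G)"

definition rank_one_relations ::
    "('g, 'b) monoid_scheme \<Rightarrow> ('g \<Rightarrow> 'k::field) \<Rightarrow> 'g \<Rightarrow> 'k \<Rightarrow> ('g gen list \<Rightarrow>\<^sub>0 'k) set" where
  "rank_one_relations G \<chi> a \<alpha> = (let n = mult_order (\<chi> a) in
     {letter (Grp g) * letter (Grp h) - letter (Grp (g \<otimes>\<^bsub>G\<^esub> h)) | g h.
        g \<in> carrier G \<and> h \<in> carrier G} \<union>
     {letter (Grp \<one>\<^bsub>G\<^esub>) - 1} \<union>
     {letter X ^ n - scalar \<alpha> * (letter (Grp a) ^ n - 1)} \<union>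
     {letter X * letter (Grp g) - scalar (\<chi> g) * letter (Grp g) * letter X | g. g \<in> carrier G})"

definition eval_free ::
    "('k::field \<Rightarrow> 'h::ring_1 \<Rightarrow> 'h) \<Rightarrow> ('s \<Rightarrow> 'h) \<Rightarrow> ('s list \<Rightarrow>\<^sub>0 'k) \<Rightarrow> 'h" where
  "eval_free scale f p =
     (\<Sum>w\<in>Poly_Mapping.keys p. scale (Poly_Mapping.lookup p w) (prod_list (map f w)))"

text \<open>The Hopf algebra of a datum is the quotient of a free algebra by an ideal. The locale describes
  it up to isomorphism, on a type \<open>'h\<close>: the algebra map from the free algebra that sends \<open>Grp g\<close> to
  \<open>\<iota> g\<close> and \<open>X\<close> to \<open>x\<close> is onto, and its kernel is the ideal generated by the relations.\<close>

locale rank_one_pointed_hopf_algebra = hopf_algebra scale \<Delta> \<epsilon>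
  for scale :: "'k::field \<Rightarrow> 'h::ring_1 \<Rightarrow> 'h" (infixr "*s" 75)
    and \<Delta> :: "'h \<Rightarrow> ('h \<times> 'h) list"
    and \<epsilon> :: "'h \<Rightarrow> 'k" +
  fixes G :: "('g, 'b) monoid_scheme"
    and \<chi> :: "'g \<Rightarrow> 'k" and a :: 'g and \<alpha> :: 'k
    and \<iota> :: "'g \<Rightarrow> 'h" and x :: 'h
  assumes datum: "rank_one_datum G \<chi> a \<alpha>"
    and generated:
      "eval_free scale (case_gen \<iota> x) ` free_algebra (rank_one_generators G) = UNIV"
    and relations:
      "{p \<in> free_algebra (rank_one_generators G). eval_free scale (case_gen \<iota> x) p = 0} =
       two_sided_ideal (free_algebra (rank_one_generators G)) (rank_one_relations G \<chi> a \<alpha>)"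
    and comult_group: "g \<in> carrier G \<Longrightarrow> tensor2_eq scale (\<Delta> (\<iota> g)) [(\<iota> g, \<iota> g)]"
    and comult_x: "tensor2_eq scale (\<Delta> x) [(x, \<iota> a), (1, x)]"

text \<open>For \<open>n = mult_order (\<chi> a)\<close> these elements form a basis. This is a consequence of the
  presentation, and it is not part of the locale. The coefficient of a monomial in \<open>v\<close> is
  \<open>representation (monomials G n \<iota> x) v\<close> at that monomial.\<close>

definition monomials :: "('g, 'b) monoid_scheme \<Rightarrow> nat \<Rightarrow> ('g \<Rightarrow> 'h::ring_1) \<Rightarrow> 'h \<Rightarrow> 'h set" where
  "monomials G n \<iota> x = {\<iota> g * x ^ m | g m. g \<in> carrier G \<and> m < n}"

end

theory Submission
  imports Defs "HOL-Algebra.Multiplicative_Group"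
begin

text \<open>Write \<open>q = \<chi>(a)\<close>, a primitive \<open>n\<close>-th root of unity with \<open>n > 1\<close>. The argument rests on two
  facts about the Hopf algebra: its grouplike elements are the group elements
  (\<open>grouplike_imp_iota\<close>), and its \<open>(1, b)\<close>-skew-primitive elements are the multiples of \<open>1 - b\<close>,
  together with \<open>x\<close> if \<open>b = a\<close> (\<open>skew_primitive_cases\<close>). Both follow from the monomial basis and
  from the \<open>q\<close>-derivative that arises by contracting one factor of the coproduct with the linear
  form ``coefficient in degree one''. The basis is obtained from the presentation: the relations act
  consistently on families of values at the monomials, so every such family extends to a linear form.

  A Hopf \<open>q\<close>-brace operation satisfies \<open>\<Delta>(u \<cdot> v) = u\<^bsub>(1)\<^esub> \<cdot> v\<^bsub>(2)\<^esub> \<otimes> u\<^bsub>(2)\<^esub> \<cdot> v\<^bsub>(1)\<^esub>\<close>. Hence group elements act on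
  group elements, \<open>1 \<cdot> g = 1\<close>, and \<open>x \<cdot> g\<close> is \<open>(1, a \<cdot> g)\<close>-skew-primitive. It is nontrivial because \<open>g\<close>
  acts invertibly, which gives \<open>a \<cdot> g = a\<close> (\<open>x_dot_group_cases\<close>). Cocommutativity of the braiding at
  \<open>x\<close> and \<open>g\<close> then yields \<open>g \<Colon> a = g\<close> and \<open>g \<Colon> x = 0\<close> (\<open>group_col_a_and_x\<close>), and the commutation of
  \<open>x\<close> with \<open>a\<close> shows that \<open>x \<cdot> g\<close> is a multiple of \<open>x\<close> (\<open>x_dot_group\<close>) and \<open>x \<cdot> x\<close> one of
  \<open>1 - a\<close> (\<open>x_dot_x\<close>), since \<open>q \<noteq> 1\<close>. The product axiom extends these formulas to monomials. The
  last claim says that \<open>\<alpha> \<noteq> 0\<close> forces \<open>a\<^sup>n\<close> to act trivially; it follows from \<open>x \<cdot> x\<^sup>n = 0\<close>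
  (\<open>alpha_lam\<close>). The axioms involved are symmetric in the two operations, so all of this holds
  with \<open>\<cdot>\<close> and \<open>\<Colon>\<close> exchanged.\<close>

section \<open>Linear maps out of a free algebra\<close>

definition lin_ext ::
    "('k::field \<Rightarrow> 'v::ab_group_add \<Rightarrow> 'v) \<Rightarrow> ('s list \<Rightarrow> 'v) \<Rightarrow> ('s list \<Rightarrow>\<^sub>0 'k) \<Rightarrow> 'v" where
  "lin_ext scale F p = (\<Sum>w\<in>Poly_Mapping.keys p. scale (Poly_Mapping.lookup p w) (F w))"

lemma list_zero_plus [simp]: "(0 :: 's list) = []" "u + v = u @ (v :: 's list)"
  by (simp_all add: zero_list_def plus_list_def)

lemma single_words_mult:
  "Poly_Mapping.single u c * Poly_Mapping.single v d = Poly_Mapping.single (u @ v) (c * d)"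
  for u v :: "'s list" and c d :: "'k::field"
  by (simp add: mult_single)

lemma one_eq_single_Nil: "(1 :: 's list \<Rightarrow>\<^sub>0 'k::field) = Poly_Mapping.single [] 1"
  by (metis list_zero_plus(1) single_one)

lemma letter_power: "letter s ^ m = (Poly_Mapping.single (replicate m s) 1 :: 's list \<Rightarrow>\<^sub>0 'k::field)"
  by (induction m) (simp_all add: letter_def single_words_mult one_eq_single_Nil)

lemma sum_monomials: "(\<Sum>w\<in>Poly_Mapping.keys p. Poly_Mapping.single w (Poly_Mapping.lookup p w)) = p"
  by (rule poly_mapping_eqI)
    (simp add: lookup_sum lookup_single when_def sum.delta' in_keys_iff)

context vector_space
begin

lemma lin_ext_superset:
  assumes "finite A" "Poly_Mapping.keys p \<subseteq> A"
  shows "lin_ext scale F p = (\<Sum>w\<in>A. scale (Poly_Mapping.lookup p w) (F w))"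
  unfolding lin_ext_def using assms by (intro sum.mono_neutral_left) (auto simp: in_keys_iff)

lemma lin_ext_single [simp]: "lin_ext scale F (Poly_Mapping.single w c) = scale c (F w)"
  by (simp add: lin_ext_def)

lemma lin_ext_0 [simp]: "lin_ext scale F 0 = 0"
  by (simp add: lin_ext_def)

lemma lin_ext_add: "lin_ext scale F (p + q) = lin_ext scale F p + lin_ext scale F q"
proof -
  let ?A = "Poly_Mapping.keys p \<union> Poly_Mapping.keys q"
  have "lin_ext scale F (p + q) = (\<Sum>w\<in>?A. scale (Poly_Mapping.lookup (p + q) w) (F w))"
    by (rule lin_ext_superset) (use Poly_Mapping.keys_add[of p q] in auto)
  also have "\<dots> = lin_ext scale F p + lin_ext scale F q"
    by (simp add: lin_ext_superset[of ?A] lookup_add scale_left_distrib sum.distrib)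
  finally show ?thesis .
qed

lemma lin_ext_minus: "lin_ext scale F (- p) = - lin_ext scale F p"
  using lin_ext_add[of F p "- p"] by (simp add: eq_neg_iff_add_eq_0 add.commute)

lemma lin_ext_diff: "lin_ext scale F (p - q) = lin_ext scale F p - lin_ext scale F q"
  using lin_ext_add[of F p "- q"] by (simp add: lin_ext_minus)

lemma lin_ext_sum: "lin_ext scale F (\<Sum>i\<in>I. f i) = (\<Sum>i\<in>I. lin_ext scale F (f i))"
  by (induction I rule: infinite_finite_induct) (simp_all add: lin_ext_add)

lemma lin_ext_scalar: "lin_ext scale F (scalar c * p) = scale c (lin_ext scale F p)"
proof -
  have "scalar c * p = (\<Sum>w\<in>Poly_Mapping.keys p. Poly_Mapping.single w (c * Poly_Mapping.lookup p w))"
    by (subst sum_monomials[of p, symmetric])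
      (simp add: sum_distrib_left scalar_def single_words_mult del: sum_monomials)
  then show ?thesis
    by (simp add: lin_ext_sum) (simp add: lin_ext_def scale_sum_right)
qed

lemma lin_ext_sum_list: "lin_ext scale F (\<Sum>i\<leftarrow>xs. f i) = (\<Sum>i\<leftarrow>xs. lin_ext scale F (f i))"
  by (induction xs) (simp_all add: lin_ext_add)

end

lemma free_algebra_mult:
  assumes "p \<in> free_algebra S" "q \<in> free_algebra S"
  shows "p * q \<in> free_algebra S"
  unfolding free_algebra_def
proof safe
  fix w s assume "w \<in> Poly_Mapping.keys (p * q)" "s \<in> set w"
  then show "s \<in> S"
    using keys_mult[of p q] assms by (fastforce simp: free_algebra_def)
qed

lemma free_algebra_add:
  "p \<in> free_algebra S \<Longrightarrow> q \<in> free_algebra S \<Longrightarrow> p + q \<in> free_algebra S"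
  using Poly_Mapping.keys_add[of p q] by (fastforce simp: free_algebra_def)

lemma free_algebra_diff:
  "p \<in> free_algebra S \<Longrightarrow> q \<in> free_algebra S \<Longrightarrow> p - q \<in> free_algebra S"
  using keys_diff[of p q] by (fastforce simp: free_algebra_def)

lemma free_algebra_scale: "p \<in> free_algebra S \<Longrightarrow> scalar c * p \<in> free_algebra S"
  by (rule free_algebra_mult) (auto simp: free_algebra_def scalar_def)

lemma free_algebra_single: "set w \<subseteq> S \<Longrightarrow> Poly_Mapping.single w c \<in> free_algebra S"
  by (auto simp: free_algebra_def)

text \<open>An ideal is spanned by the products \<open>w\<^sub>1 r w\<^sub>2\<close> of a generator \<open>r\<close> with words, so these are all
  that has to be inspected in order to see that a linear map factors through the quotient.\<close>

lemma (in vector_space) lin_ext_ideal: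
  assumes rel: "\<And>r w1 w2 c1 c2. r \<in> R \<Longrightarrow> set w1 \<subseteq> S \<Longrightarrow> set w2 \<subseteq> S \<Longrightarrow>
      lin_ext scale F (Poly_Mapping.single w1 c1 * r * Poly_Mapping.single w2 c2) = 0"
    and r: "r \<in> two_sided_ideal (free_algebra S) R"
  shows "lin_ext scale F r = 0"
proof -
  have "lin_ext scale F (p * r * q) = 0" if "p \<in> free_algebra S" "q \<in> free_algebra S" for p q
    using r that
  proof (induction arbitrary: p q)
    case (rel r)
    let ?m = "\<lambda>p w. Poly_Mapping.single w (Poly_Mapping.lookup p w)"
    have "p * r * q = (\<Sum>w\<in>Poly_Mapping.keys p. ?m p w) * r * (\<Sum>w\<in>Poly_Mapping.keys q. ?m q w)"
      by (simp only: sum_monomials)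
    also have "\<dots> = (\<Sum>v\<in>Poly_Mapping.keys p. \<Sum>w\<in>Poly_Mapping.keys q. ?m p v * r * ?m q w)"
      by (simp add: sum_distrib_left sum_distrib_right) (rule sum.swap)
    finally show ?case
      using rel assms(1) by (auto simp: lin_ext_sum free_algebra_def intro!: sum.neutral)
  next
    case (mult_left p' r)
    have "p * (p' * r) * q = (p * p') * r * q" by (simp add: mult.assoc)
    with mult_left show ?case by (simp add: free_algebra_mult)
  next
    case (mult_right p' r)
    have "p * (r * p') * q = p * r * (p' * q)" by (simp add: mult.assoc)
    with mult_right show ?case by (simp add: free_algebra_mult)
  qed (simp_all add: distrib_left distrib_right lin_ext_add)
  moreover have "1 \<in> free_algebra S"
    by (simp add: one_eq_single_Nil free_algebra_single)
  ultimately show ?thesis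
    using mult_1_left mult_1_right by metis
qed

section \<open>Sweedler notation\<close>

text \<open>A function on words that is linear in every letter kills all products of a tensor relation with
  words, so it factors through the tensor algebra. Every equality of tensors is used below through its
  image under a multilinear map.\<close>

lemma (in vector_space) tensor_eq_multilinear:
  assumes add: "\<And>v w s t. F (v @ [s + t] @ w) = F (v @ [s] @ w) + F (v @ [t] @ w)"
    and scale: "\<And>v w c s. F (v @ [scale c s] @ w) = scale c (F (v @ [s] @ w))"
    and eq: "tensor_eq scale s t"
  shows "(\<Sum>w\<leftarrow>s. F w) = (\<Sum>w\<leftarrow>t. F w)"
proof -
  have "lin_ext scale F ((\<Sum>w\<leftarrow>s. Poly_Mapping.single w 1) - (\<Sum>w\<leftarrow>t. Poly_Mapping.single w 1)) = 0"
  proof (rule lin_ext_ideal)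
    show "(\<Sum>w\<leftarrow>s. Poly_Mapping.single w 1) - (\<Sum>w\<leftarrow>t. Poly_Mapping.single w 1)
        \<in> two_sided_ideal (free_algebra UNIV) (tensor_relations scale)"
      using eq by (simp add: tensor_eq_def free_algebra_def)
    fix r w1 w2 c1 c2 assume "r \<in> tensor_relations scale"
    then consider
        (add) u v where "r = Poly_Mapping.single [u + v] 1 - Poly_Mapping.single [u] 1 - Poly_Mapping.single [v] 1"
      | (scale) c u where "r = Poly_Mapping.single [scale c u] 1 - Poly_Mapping.single [u] c"
      by (auto simp: tensor_relations_def letter_def scalar_def single_words_mult)
    then show "lin_ext scale F (Poly_Mapping.single w1 c1 * r * Poly_Mapping.single w2 c2) = 0"
    proof cases
      case add
      then show ?thesis using assms(1)[of w1 _ _ w2]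
        by (simp add: left_diff_distrib right_diff_distrib single_words_mult lin_ext_diff
            scale_right_distrib)
    next
      case scale
      then show ?thesis using assms(2)[of w1 _ _ w2]
        by (simp add: left_diff_distrib right_diff_distrib single_words_mult lin_ext_diff
            mult.commute mult.left_commute)
    qed
  qed
  then show ?thesis
    by (simp add: lin_ext_diff lin_ext_sum_list)
qed

lemma sum_list_concat_map: "sum_list (concat (map f xs)) = (\<Sum>x\<leftarrow>xs. sum_list (f x))"
  by (induction xs) simp_all

lemma sum_list_swap: "(\<Sum>p\<leftarrow>xs. \<Sum>q\<leftarrow>ys. g p q) = (\<Sum>q\<leftarrow>ys. \<Sum>p\<leftarrow>xs. g p q)"
  for g :: "'a \<Rightarrow> 'b \<Rightarrow> 'c::comm_monoid_add"
  by (induction xs) (simp_all add: sum_list_addf)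

context coalgebra
begin

abbreviation lin :: "('h \<Rightarrow> 'h) \<Rightarrow> bool" where "lin \<equiv> Vector_Spaces.linear scale scale"

abbreviation functional :: "('h \<Rightarrow> 'k) \<Rightarrow> bool" where "functional \<equiv> Vector_Spaces.linear scale (*)"

lemma linI:
  "(\<And>u v. f (u + v) = f u + f v) \<Longrightarrow> (\<And>c u. f (c *s u) = c *s f u) \<Longrightarrow> lin f"
  by (simp add: Vector_Spaces.linear_iff vector_space_axioms)

lemma lin_add: "lin f \<Longrightarrow> f (u + v) = f u + f v"
  and lin_scale: "lin f \<Longrightarrow> f (c *s u) = c *s f u"
  by (simp_all add: Vector_Spaces.linear_iff)

lemma lin_0: "lin f \<Longrightarrow> f 0 = 0"
  using lin_add[of f 0 0] by simp

lemma lin_diff: "lin f \<Longrightarrow> f (u - v) = f u - f v"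
  using lin_add[of f "u - v" v] by simp

lemma vector_space_field: "vector_space ((*) :: 'k \<Rightarrow> 'k \<Rightarrow> 'k)"
  by standard (simp_all add: algebra_simps)

lemma functionalI:
  "(\<And>u v. \<phi> (u + v) = \<phi> u + \<phi> v) \<Longrightarrow> (\<And>c u. \<phi> (c *s u) = c * \<phi> u) \<Longrightarrow> functional \<phi>"
  by (simp add: Vector_Spaces.linear_iff vector_space_axioms vector_space_field)

lemma functional_add: "functional \<phi> \<Longrightarrow> \<phi> (u + v) = \<phi> u + \<phi> v"
  and functional_scale: "functional \<phi> \<Longrightarrow> \<phi> (c *s u) = c * \<phi> u"
  by (simp_all add: Vector_Spaces.linear_iff)

lemma functional_0: "functional \<phi> \<Longrightarrow> \<phi> 0 = 0"
  using functional_scale[of \<phi> 0 0] by simp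

lemma functional_diff: "functional \<phi> \<Longrightarrow> \<phi> (u - v) = \<phi> u - \<phi> v"
  using functional_add[of \<phi> "u - v" v] by simp

lemma functional_sum: "functional \<phi> \<Longrightarrow> \<phi> (\<Sum>i\<in>I. f i) = (\<Sum>i\<in>I. \<phi> (f i))"
  by (induction I rule: infinite_finite_induct) (simp_all add: functional_0 functional_add)

lemma lin_id: "lin (\<lambda>u. u)"
  by (rule linI) simp_all

lemma lin_compose: "lin g \<Longrightarrow> lin f \<Longrightarrow> lin (\<lambda>u. g (f u))"
  by (rule linI) (simp_all add: lin_add lin_scale)

lemma lin_plus: "lin f \<Longrightarrow> lin g \<Longrightarrow> lin (\<lambda>u. f u + g u)"
  by (rule linI) (simp_all add: lin_add lin_scale scale_right_distrib)

lemma lin_scale_const: "lin f \<Longrightarrow> lin (\<lambda>u. c *s f u)"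
  by (rule linI) (simp_all add: lin_add lin_scale scale_right_distrib scale_left_commute)

lemma lin_functional_scale: "functional \<phi> \<Longrightarrow> lin f \<Longrightarrow> lin (\<lambda>u. \<phi> (f u) *s v)"
  by (rule linI)
    (simp_all add: lin_add lin_scale functional_add functional_scale scale_left_distrib)

lemma lin_functional: "functional \<phi> \<Longrightarrow> lin (\<lambda>u. \<phi> u *s v)"
  using lin_functional_scale[OF _ lin_id] .

lemma lin_sum: "lin f \<Longrightarrow> f (\<Sum>i\<in>I. g i) = (\<Sum>i\<in>I. f (g i))"
  by (induction I rule: infinite_finite_induct) (simp_all add: lin_0 lin_add)

lemma lin_sum_list:
  assumes "\<And>i. i \<in> set xs \<Longrightarrow> lin (\<lambda>u. f u i)"
  shows "lin (\<lambda>u. \<Sum>i\<leftarrow>xs. f u i)"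
  using assms
proof (induction xs)
  case Nil
  show ?case by (rule linI) simp_all
next
  case (Cons i xs)
  have "lin (\<lambda>u. f u i)" "lin (\<lambda>u. \<Sum>i\<leftarrow>xs. f u i)"
    using Cons by simp_all
  from this[THEN lin_add] this[THEN lin_scale] show ?case
    by (intro linI) (simp_all add: scale_right_distrib)
qed

definition bilin :: "('h \<Rightarrow> 'h \<Rightarrow> 'h) \<Rightarrow> bool" where
  "bilin f \<longleftrightarrow> (\<forall>v. lin (\<lambda>u. f u v)) \<and> (\<forall>u. lin (f u))"

lemma bilinI: "(\<And>v. lin (\<lambda>u. f u v)) \<Longrightarrow> (\<And>u. lin (\<lambda>v. f u v)) \<Longrightarrow> bilin f"
  by (simp add: bilin_def)

lemma bilin_lin:
  assumes "bilin f" "lin g"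
  shows "lin (\<lambda>u. f (g u) v)" "lin (\<lambda>u. f v (g u))"
proof -
  have f: "lin (\<lambda>u. f u v)" "lin (f v)" for v
    using assms(1) by (simp_all add: bilin_def)
  show "lin (\<lambda>u. f (g u) v)" "lin (\<lambda>u. f v (g u))"
    by (intro linI; simp add: lin_add[OF assms(2)] lin_scale[OF assms(2)] f[THEN lin_add]
        f[THEN lin_scale])+
qed

lemma tensor2_eq_bilin:
  assumes f: "bilin f" and eq: "tensor2_eq scale s t"
  shows "(\<Sum>(u, v)\<leftarrow>s. f u v) = (\<Sum>(u, v)\<leftarrow>t. f u v)"
proof -
  define F where "F w = (if length w = 2 then f (w ! 0) (w ! 1) else 0)" for w
  have lin: "lin (\<lambda>s. F (v @ [s] @ w))" for v w
  proof (cases "length v + length w = 1")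
    case True
    then consider t where "v = []" "w = [t]" | t where "v = [t]" "w = []"
      by (cases v; cases w) auto
    then show ?thesis
      using f by cases (auto simp: F_def bilin_def)
  next
    case False
    then show ?thesis by (intro linI) (auto simp: F_def)
  qed
  have "(\<Sum>w\<leftarrow>[[u, v]. (u, v) \<leftarrow> s]. F w) = (\<Sum>w\<leftarrow>[[u, v]. (u, v) \<leftarrow> t]. F w)"
    using lin_add[OF lin] lin_scale[OF lin] eq
    by (intro tensor_eq_multilinear) (simp_all add: tensor2_eq_def)
  moreover have "(\<Sum>w\<leftarrow>[[u, v]. (u, v) \<leftarrow> s]. F w) = (\<Sum>(u, v)\<leftarrow>s. f u v)" for s
    by (induction s) (auto simp: F_def)
  ultimately show ?thesis by simp
qed

text \<open>Contracting one tensor factor with a linear form \<open>\<phi>\<close>, that is, applying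
  \<open>\<phi> \<otimes> id\<close> or \<open>id \<otimes> \<phi>\<close>, is the bilinear map most often evaluated on a coproduct.\<close>

lemma bilin_slice_left: "functional \<phi> \<Longrightarrow> bilin (\<lambda>p q. \<phi> p *s q)"
  by (intro bilinI lin_functional_scale lin_scale_const lin_id)

lemma bilin_slice_right: "functional \<phi> \<Longrightarrow> bilin (\<lambda>p q. \<phi> q *s p)"
  by (intro bilinI lin_functional_scale lin_scale_const lin_id)

text \<open>Sweedler's \<open>f(u\<^bsub>(1)\<^esub>, u\<^bsub>(2)\<^esub>)\<close>. For bilinear \<open>f\<close> it depends on the tensor
  represented by \<open>\<Delta> u\<close> only.\<close>

definition sweedler :: "('h \<Rightarrow> 'h \<Rightarrow> 'h) \<Rightarrow> 'h \<Rightarrow> 'h" where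
  "sweedler f u = (\<Sum>(u1, u2)\<leftarrow>\<Delta> u. f u1 u2)"

lemma sweedler_eqI:
  "bilin f \<Longrightarrow> tensor2_eq scale (\<Delta> u) t \<Longrightarrow> sweedler f u = (\<Sum>(u1, u2)\<leftarrow>t. f u1 u2)"
  unfolding sweedler_def by (rule tensor2_eq_bilin)

lemma sum_list_scale: "(\<Sum>i\<leftarrow>xs. c *s f i) = c *s (\<Sum>i\<leftarrow>xs. f i)"
  by (induction xs) (simp_all add: scale_right_distrib)

lemma lin_sweedler: "bilin f \<Longrightarrow> lin (sweedler f)"
proof (rule linI)
  assume f: "bilin f"
  show "sweedler f (u + v) = sweedler f u + sweedler f v" for u v
    using sweedler_eqI[OF f comult_add] by (simp add: sweedler_def)
  show "sweedler f (c *s u) = c *s sweedler f u" for c u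
  proof -
    have "sweedler f (c *s u) = (\<Sum>(u1, u2)\<leftarrow>\<Delta> u. f (c *s u1) u2)"
      using sweedler_eqI[OF f comult_scale] by (simp add: case_prod_unfold map_concat comp_def)
    also have "\<dots> = (\<Sum>(u1, u2)\<leftarrow>\<Delta> u. c *s f u1 u2)"
      using lin_scale[of "\<lambda>u. f u v" for v] f by (simp add: bilin_def)
    finally show ?thesis
      by (simp add: sweedler_def case_prod_unfold sum_list_scale)
  qed
qed

lemma lin_sweedler_param:
  "(\<And>p q. lin (\<lambda>u. f u p q)) \<Longrightarrow> lin (\<lambda>u. sweedler (f u) v)"
  unfolding sweedler_def by (intro lin_sum_list) auto

lemma sweedler_add: "sweedler (\<lambda>p q. f p q + g p q) u = sweedler f u + sweedler g u"
  unfolding sweedler_def by (induction "\<Delta> u" rule: rev_induct) (simp_all add: case_prod_unfold sum_list_addf)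

lemma sweedler_swap:
  "sweedler (\<lambda>u1 u2. sweedler (\<lambda>v1 v2. f u1 u2 v1 v2) v) u
     = sweedler (\<lambda>v1 v2. sweedler (\<lambda>u1 u2. f u1 u2 v1 v2) u) v"
  unfolding sweedler_def case_prod_unfold by (rule sum_list_swap)

lemma lin_sweedler_commute: "lin f \<Longrightarrow> f (sweedler g u) = sweedler (\<lambda>p q. f (g p q)) u"
proof -
  assume f: "lin f"
  have "f (\<Sum>(p, q)\<leftarrow>xs. g p q) = (\<Sum>(p, q)\<leftarrow>xs. f (g p q))" for xs
    by (induction xs) (auto simp: lin_0[OF f] lin_add[OF f])
  then show ?thesis by (simp add: sweedler_def)
qed

lemmas functional_counit = counit_linear

lemma sweedler_counit_left: "lin g \<Longrightarrow> sweedler (\<lambda>p q. \<epsilon> p *s g q) u = g u"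
  using lin_sweedler_commute[of g "\<lambda>p q. \<epsilon> p *s q" u] counit_left[of u]
  by (simp add: sweedler_def lin_scale)

lemma sweedler_counit_right: "lin g \<Longrightarrow> sweedler (\<lambda>p q. \<epsilon> q *s g p) u = g u"
  using lin_sweedler_commute[of g "\<lambda>p q. \<epsilon> q *s p" u] counit_right[of u]
  by (simp add: sweedler_def lin_scale)

definition quad :: "('h \<Rightarrow> 'h \<Rightarrow> 'h \<Rightarrow> 'h \<Rightarrow> 'h) \<Rightarrow> 'h list \<Rightarrow> 'h" where
  "quad F w = (if length w = 4 then F (w ! 0) (w ! 1) (w ! 2) (w ! 3) else 0)"

lemma tensor_eq_quad:
  assumes lin: "\<And>q r s. lin (\<lambda>p. F p q r s)" "\<And>p r s. lin (\<lambda>q. F p q r s)"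
      "\<And>p q s. lin (\<lambda>r. F p q r s)" "\<And>p q r. lin (\<lambda>s. F p q r s)"
    and eq: "tensor_eq scale s t"
  shows "(\<Sum>w\<leftarrow>s. quad F w) = (\<Sum>w\<leftarrow>t. quad F w)"
proof -
  have "lin (\<lambda>s. quad F (v @ [s] @ w))" for v w
  proof (cases "length v + length w = 3")
    case True
    then consider "length v = 0" "length w = 3" | "length v = 1" "length w = 2"
      | "length v = 2" "length w = 1" | "length v = 3" "length w = 0"
      by linarith
    then consider q r s where "v = []" "w = [q, r, s]" | p r s where "v = [p]" "w = [r, s]"
      | p q s where "v = [p, q]" "w = [s]" | p q r where "v = [p, q, r]" "w = []"
    proof cases
      case 1
      then show ?thesis using that(1) by (auto simp: numeral_eq_Suc length_Suc_conv)
    next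
      case 2
      then show ?thesis using that(2) by (auto simp: numeral_eq_Suc length_Suc_conv)
    next
      case 3
      then show ?thesis using that(3) by (auto simp: numeral_eq_Suc length_Suc_conv)
    next
      case 4
      then show ?thesis using that(4) by (auto simp: numeral_eq_Suc length_Suc_conv)
    qed
    then show ?thesis
      by cases (simp_all add: quad_def lin)
  next
    case False
    then show ?thesis by (intro linI) (auto simp: quad_def)
  qed
  from this[THEN lin_add] this[THEN lin_scale] eq show ?thesis
    by (intro tensor_eq_multilinear)
qed

text \<open>The equation \<open>\<Delta> u = u \<otimes> u\<close> is tested on bilinear maps, in accordance with
  \<open>tensor2_eq_bilin\<close>; the same is done for \<open>\<Delta> u = u \<otimes> b + 1 \<otimes> u\<close> further below.\<close>

definition grouplike :: "'h \<Rightarrow> bool" where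
  "grouplike u \<longleftrightarrow> \<epsilon> u = 1 \<and> (\<forall>f. bilin f \<longrightarrow> sweedler f u = f u u)"

end

context hopf_algebra
begin

lemma lin_mult_right: "lin f \<Longrightarrow> lin (\<lambda>u. f u * v)"
  by (rule linI) (simp_all add: lin_add lin_scale distrib_right scale_mult_left)

lemma lin_mult_left: "lin f \<Longrightarrow> lin (\<lambda>u. v * f u)"
  by (rule linI) (simp_all add: lin_add lin_scale distrib_left scale_mult_right)

lemma sweedler_mult:
  assumes "bilin f"
  shows "sweedler f (u * v) = sweedler (\<lambda>u1 u2. sweedler (\<lambda>v1 v2. f (u1 * v1) (u2 * v2)) v) u"
proof -
  have "(\<Sum>(p, q)\<leftarrow>[(u1 * v1, u2 * v2). (u1, u2) \<leftarrow> us, (v1, v2) \<leftarrow> vs]. f p q) =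
        (\<Sum>(u1, u2)\<leftarrow>us. \<Sum>(v1, v2)\<leftarrow>vs. f (u1 * v1) (u2 * v2))" for us vs
    by (induction us) (auto simp: case_prod_unfold map_concat comp_def)
  then show ?thesis
    using sweedler_eqI[OF assms comult_mult] by (simp add: sweedler_def)
qed

definition skew_primitive :: "'h \<Rightarrow> 'h \<Rightarrow> bool" where
  "skew_primitive b u \<longleftrightarrow> (\<forall>f. bilin f \<longrightarrow> sweedler f u = f u b + f 1 u)"

end

section \<open>The monomial basis\<close>

text \<open>The transpose of right multiplication by a generator, on linear forms \<open>f\<close> that are given by
  their values \<open>f g m\<close> at the monomials \<open>g x\<^sup>m\<close> with \<open>m < n\<close>. The second branch for
  \<^const>\<open>X\<close> rewrites \<open>g x\<^sup>n\<close> as \<open>\<alpha> (g a\<^sup>n - g)\<close>.\<close>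

fun gen_act ::
    "('g, 'b) monoid_scheme \<Rightarrow> ('g \<Rightarrow> 'k::field) \<Rightarrow> 'g \<Rightarrow> 'k \<Rightarrow> nat \<Rightarrow> 'g gen \<Rightarrow>
     ('g \<Rightarrow> nat \<Rightarrow> 'k) \<Rightarrow> 'g \<Rightarrow> nat \<Rightarrow> 'k" where
  "gen_act G \<chi> a \<alpha> n (Grp h) f = (\<lambda>g m. \<chi> h ^ m * f (g \<otimes>\<^bsub>G\<^esub> h) m)"
| "gen_act G \<chi> a \<alpha> n X f = (\<lambda>g m. if Suc m < n then f g (Suc m)
     else \<alpha> * (f (g \<otimes>\<^bsub>G\<^esub> a [^]\<^bsub>G\<^esub> n) 0 - f g 0))"

locale rank_one = rank_one_pointed_hopf_algebra scale \<Delta> \<epsilon> G \<chi> a \<alpha> \<iota> x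
  for scale :: "'k::field \<Rightarrow> 'h::ring_1 \<Rightarrow> 'h" (infixr "*s" 75)
    and \<Delta> :: "'h \<Rightarrow> ('h \<times> 'h) list"
    and \<epsilon> :: "'h \<Rightarrow> 'k"
    and G :: "('g, 'b) monoid_scheme"
    and \<chi> :: "'g \<Rightarrow> 'k" and a :: 'g and \<alpha> :: 'k
    and \<iota> :: "'g \<Rightarrow> 'h" and x :: 'h
begin

definition n :: nat where "n = mult_order (\<chi> a)"

lemma group_G: "group G" and finite_G [simp]: "finite (carrier G)"
  and chi_nonzero: "g \<in> carrier G \<Longrightarrow> \<chi> g \<noteq> 0"
  and chi_mult: "g \<in> carrier G \<Longrightarrow> h \<in> carrier G \<Longrightarrow> \<chi> (g \<otimes>\<^bsub>G\<^esub> h) = \<chi> g * \<chi> h"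
  and a_carrier [simp]: "a \<in> carrier G"
  and a_central: "g \<in> carrier G \<Longrightarrow> a \<otimes>\<^bsub>G\<^esub> g = g \<otimes>\<^bsub>G\<^esub> a"
  and n_gt_1: "1 < n"
  using datum by (simp_all add: rank_one_datum_def n_def)

lemma datum_cases: "a [^]\<^bsub>G\<^esub> n = \<one>\<^bsub>G\<^esub> \<or> \<alpha> = 0 \<or> (\<forall>g\<in>carrier G. \<chi> g ^ n = 1)"
proof -
  have "a [^]\<^bsub>G\<^esub> n = \<one>\<^bsub>G\<^esub> \<or> \<alpha> = 0"
    if "Poly_Mapping.single (a [^]\<^bsub>G\<^esub> n) \<alpha> - Poly_Mapping.single \<one>\<^bsub>G\<^esub> \<alpha> = 0"
  proof -
    have "Poly_Mapping.lookup (Poly_Mapping.single (a [^]\<^bsub>G\<^esub> n) \<alpha>) \<one>\<^bsub>G\<^esub> = \<alpha>"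
      using that by simp
    then show ?thesis by (simp add: lookup_single when_def split: if_splits)
  qed
  with datum show ?thesis
    by (auto simp: rank_one_datum_def n_def)
qed

lemma chi_one: "\<chi> \<one>\<^bsub>G\<^esub> = 1"
proof -
  interpret group G by (rule group_G)
  have "\<chi> \<one>\<^bsub>G\<^esub> * \<chi> \<one>\<^bsub>G\<^esub> = \<chi> \<one>\<^bsub>G\<^esub>"
    using chi_mult[of "\<one>\<^bsub>G\<^esub>" "\<one>\<^bsub>G\<^esub>"] by simp
  then show ?thesis using chi_nonzero[of "\<one>\<^bsub>G\<^esub>"] by simp
qed

lemma chi_pow: "g \<in> carrier G \<Longrightarrow> \<chi> (g [^]\<^bsub>G\<^esub> (m :: nat)) = \<chi> g ^ m"
proof -
  interpret group G by (rule group_G)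
  show "g \<in> carrier G \<Longrightarrow> \<chi> (g [^]\<^bsub>G\<^esub> m) = \<chi> g ^ m"
    by (induction m) (simp_all add: chi_one chi_mult mult.commute)
qed

lemma chi_a_power_n: "\<chi> a ^ n = 1" and chi_a_power_less: "0 < m \<Longrightarrow> m < n \<Longrightarrow> \<chi> a ^ m \<noteq> 1"
proof -
  interpret group G by (rule group_G)
  have "\<chi> a ^ Coset.order G = 1" "0 < Coset.order G"
    using pow_order_eq_1[OF a_carrier] chi_pow[OF a_carrier] chi_one finite_G
    by (metis, simp add: order_gt_0_iff_finite)
  then have "\<exists>m. 0 < m \<and> \<chi> a ^ m = 1" by blast
  from LeastI_ex[OF this] show "\<chi> a ^ n = 1" by (simp add: n_def mult_order_def)
  show "\<chi> a ^ m \<noteq> 1" if "0 < m" "m < n"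
    using that not_less_Least unfolding n_def mult_order_def by blast
qed

abbreviation op :: "'g gen \<Rightarrow> ('g \<Rightarrow> nat \<Rightarrow> 'k) \<Rightarrow> 'g \<Rightarrow> nat \<Rightarrow> 'k" where
  "op \<equiv> gen_act G \<chi> a \<alpha> n"

abbreviation act :: "'g gen list \<Rightarrow> ('g \<Rightarrow> nat \<Rightarrow> 'k) \<Rightarrow> 'g \<Rightarrow> nat \<Rightarrow> 'k" where
  "act w f \<equiv> foldr op w f"

abbreviation gens :: "'g gen set" where "gens \<equiv> rank_one_generators G"

lemma gens_cases:
  assumes "s \<in> gens"
  obtains "s = X" | h where "s = Grp h" "h \<in> carrier G"
  using assms by (auto simp: rank_one_generators_def)

text \<open>The defining relations will be verified only at the monomials \<open>g x\<^sup>m\<close> with \<open>g\<close> in the group and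
  \<open>m < n\<close>. Such an identity survives the action of a further word, since the action is linear and
  its values at these monomials depend only on values at these monomials.\<close>

lemma act_combination:
  assumes "set w \<subseteq> gens"
    and "\<And>g m. g \<in> carrier G \<Longrightarrow> m < n \<Longrightarrow> f g m = c * f1 g m + d * f2 g m"
    and "g \<in> carrier G" "m < n"
  shows "act w f g m = c * act w f1 g m + d * act w f2 g m"
  using assms
proof (induction w arbitrary: g m)
  case (Cons s w)
  interpret group G by (rule group_G)
  have IH: "act w f g m = c * act w f1 g m + d * act w f2 g m" if "g \<in> carrier G" "m < n" for g m
    using Cons that by simp
  from Cons.prems have "s \<in> gens" by simp
  then show ?case
  proof (cases rule: gens_cases)
    case 1
    show ?thesis
      using IH[of g "Suc m"] IH[of "g \<otimes>\<^bsub>G\<^esub> a [^]\<^bsub>G\<^esub> n" 0] IH[of g 0] Cons.prems(3,4) a_carrier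
      by (simp add: 1 distrib_left right_diff_distrib mult.left_commute)
  next
    case (2 h)
    show ?thesis
      using IH[of "g \<otimes>\<^bsub>G\<^esub> h" m] Cons.prems(3,4) 2
      by (simp add: distrib_left mult.left_commute)
  qed
qed simp

text \<open>The exponent of \<open>g x\<^bsup>m+j\<^esup>\<close> is less than \<open>2n\<close>, so its expansion uses \<open>x\<^sup>n = \<alpha> (a\<^sup>n - 1)\<close> at most
  once.\<close>

lemma act_X_power:
  assumes "j \<le> n" "g \<in> carrier G" "m < n"
  shows "act (replicate j X) f g m = (if m + j < n then f g (m + j)
    else \<alpha> * (f (g \<otimes>\<^bsub>G\<^esub> a [^]\<^bsub>G\<^esub> n) (m + j - n) - f g (m + j - n)))"
  using assms
proof (induction j arbitrary: g m)
  case (Suc j)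
  interpret group G by (rule group_G)
  show ?case
  proof (cases "Suc m < n")
    case True
    then show ?thesis using Suc by simp
  next
    case False
    then have "Suc m = n" "m + Suc j - n = j" using Suc by simp_all
    moreover have "Suc (m + j) - n = j" "0 < n" using calculation by auto
    ultimately show ?thesis using Suc a_carrier by simp
  qed
qed simp

lemma act_group_power:
  assumes "g \<in> carrier G" "h \<in> carrier G"
  shows "act (replicate j (Grp h)) f g m = \<chi> h ^ (j * m) * f (g \<otimes>\<^bsub>G\<^esub> h [^]\<^bsub>G\<^esub> j) m"
  using assms
proof (induction j arbitrary: g)
  case 0
  interpret group G by (rule group_G)
  show ?case using 0 by simp
next
  case (Suc j)
  interpret group G by (rule group_G)
  have "act (replicate (Suc j) (Grp h)) f g m
      = \<chi> h ^ m * (\<chi> h ^ (j * m) * f (g \<otimes>\<^bsub>G\<^esub> h \<otimes>\<^bsub>G\<^esub> h [^]\<^bsub>G\<^esub> j) m)"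
    using Suc by simp
  also have "g \<otimes>\<^bsub>G\<^esub> h \<otimes>\<^bsub>G\<^esub> h [^]\<^bsub>G\<^esub> j = g \<otimes>\<^bsub>G\<^esub> h [^]\<^bsub>G\<^esub> Suc j"
    using Suc.prems by (subst nat_pow_Suc2) (simp_all add: m_assoc)
  finally show ?case by (simp add: power_add)
qed

text \<open>The transposes satisfy the defining relations. The condition on a datum is used for
  \<open>xg = \<chi>(g)gx\<close>, at the monomials of degree \<open>n - 1\<close>.\<close>

lemma act_relations:
  assumes h: "h \<in> carrier G" and g: "g \<in> carrier G" and m: "m < n"
  shows "h' \<in> carrier G \<Longrightarrow> act [Grp h, Grp h'] f g m = act [Grp (h \<otimes>\<^bsub>G\<^esub> h')] f g m"
    and "act [Grp \<one>\<^bsub>G\<^esub>] f g m = f g m"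
    and "act (replicate n X) f g m = \<alpha> * act (replicate n (Grp a)) f g m - \<alpha> * f g m"
    and "act [X, Grp h] f g m = \<chi> h * act [Grp h, X] f g m"
proof -
  interpret group G by (rule group_G)
  show "act [Grp h, Grp h'] f g m = act [Grp (h \<otimes>\<^bsub>G\<^esub> h')] f g m" if "h' \<in> carrier G"
    using that h g by (simp add: m_assoc chi_mult power_mult_distrib)
  show "act [Grp \<one>\<^bsub>G\<^esub>] f g m = f g m"
    using g by (simp add: chi_one)
  show "act (replicate n X) f g m = \<alpha> * act (replicate n (Grp a)) f g m - \<alpha> * f g m"
    using g m a_carrier act_X_power[of n g m f] act_group_power[of g a n f m]
    by (simp add: power_mult chi_a_power_n right_diff_distrib)
  have comm: "g \<otimes>\<^bsub>G\<^esub> a [^]\<^bsub>G\<^esub> n \<otimes>\<^bsub>G\<^esub> h = g \<otimes>\<^bsub>G\<^esub> h \<otimes>\<^bsub>G\<^esub> a [^]\<^bsub>G\<^esub> n"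
  proof -
    have "a [^]\<^bsub>G\<^esub> k \<otimes>\<^bsub>G\<^esub> h = h \<otimes>\<^bsub>G\<^esub> a [^]\<^bsub>G\<^esub> k" for k :: nat
      by (rule group_commutes_pow) (use a_central[OF h] a_carrier h in simp_all)
    then show ?thesis using g h a_carrier by (simp add: m_assoc)
  qed
  show "act [X, Grp h] f g m = \<chi> h * act [Grp h, X] f g m"
  proof (cases "Suc m < n")
    case False
    then have "n = Suc m" using m by simp
    then have "\<chi> h * \<chi> h ^ m * \<alpha> * (f (g \<otimes>\<^bsub>G\<^esub> h \<otimes>\<^bsub>G\<^esub> a [^]\<^bsub>G\<^esub> n) 0 - f (g \<otimes>\<^bsub>G\<^esub> h) 0)
        = \<alpha> * (f (g \<otimes>\<^bsub>G\<^esub> h \<otimes>\<^bsub>G\<^esub> a [^]\<^bsub>G\<^esub> n) 0 - f (g \<otimes>\<^bsub>G\<^esub> h) 0)"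
      using datum_cases h g by auto
    then show ?thesis using False comm by (simp add: algebra_simps)
  qed simp
qed

lemma relation_cases:
  assumes "r \<in> rank_one_relations G \<chi> a \<alpha>"
  obtains (mult) g h where "g \<in> carrier G" "h \<in> carrier G"
      "r = Poly_Mapping.single [Grp g, Grp h] 1 - Poly_Mapping.single [Grp (g \<otimes>\<^bsub>G\<^esub> h)] 1"
  | (one) "r = Poly_Mapping.single [Grp \<one>\<^bsub>G\<^esub>] 1 - Poly_Mapping.single [] 1"
  | (pow) "r = Poly_Mapping.single (replicate n X) 1
        - (Poly_Mapping.single (replicate n (Grp a)) \<alpha> - Poly_Mapping.single [] \<alpha>)"
  | (comm) g where "g \<in> carrier G"
      "r = Poly_Mapping.single [X, Grp g] 1 - Poly_Mapping.single [Grp g, X] (\<chi> g)"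
proof -
  note monomial_simps = letter_def scalar_def single_words_mult one_eq_single_Nil right_diff_distrib
  from assms consider
      g h where "g \<in> carrier G" "h \<in> carrier G"
        "r = letter (Grp g) * letter (Grp h) - letter (Grp (g \<otimes>\<^bsub>G\<^esub> h))"
    | "r = letter (Grp \<one>\<^bsub>G\<^esub>) - 1"
    | "r = letter X ^ n - scalar \<alpha> * (letter (Grp a) ^ n - 1)"
    | g where "g \<in> carrier G" "r = letter X * letter (Grp g) - scalar (\<chi> g) * letter (Grp g) * letter X"
    unfolding rank_one_relations_def Let_def n_def by blast
  then show thesis
  proof cases
    case 1
    then show ?thesis by (intro mult) (simp_all add: monomial_simps)
  next
    case 2
    then show ?thesis by (intro one) (simp add: monomial_simps)
  next
    case 3
    then show ?thesis
      unfolding letter_power by (intro pow) (simp add: monomial_simps)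
  next
    case 4
    then show ?thesis by (intro comm) (simp_all add: monomial_simps)
  qed
qed

text \<open>Hence every family of values at the monomials \<open>g x\<^sup>m\<close> with \<open>m < n\<close> extends to a linear form:
  evaluate the transposed action of a preimage in the free algebra at \<open>1 = 1 x\<^sup>0\<close>.\<close>

lemma functional_exists:
  obtains \<phi> where "functional \<phi>"
    "\<And>g m. g \<in> carrier G \<Longrightarrow> m < n \<Longrightarrow> \<phi> (\<iota> g * x ^ m) = f g m"
proof -
  interpret group G by (rule group_G)
  interpret k: vector_space "(*) :: 'k \<Rightarrow> 'k \<Rightarrow> 'k" by (rule vector_space_field)
  let ?A = "free_algebra gens :: ('g gen list \<Rightarrow>\<^sub>0 'k) set"
  let ?ev = "eval_free scale (case_gen \<iota> x)"
  let ?F = "\<lambda>w. act w f \<one>\<^bsub>G\<^esub> 0"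
  have ev: "?ev = lin_ext scale (\<lambda>w. prod_list (map (case_gen \<iota> x) w))"
    by (rule ext) (simp add: eval_free_def lin_ext_def)
  have kernel: "lin_ext (*) ?F p = 0" if "p \<in> ?A" "?ev p = 0" for p
  proof (rule k.lin_ext_ideal)
    show "p \<in> two_sided_ideal ?A (rank_one_relations G \<chi> a \<alpha>)"
      using that relations by blast
  next
    fix r w1 w2 c1 c2
    assume r: "r \<in> rank_one_relations G \<chi> a \<alpha>" and w: "set w1 \<subseteq> gens" "set w2 \<subseteq> gens"
    have comb: "act w1 f0 \<one>\<^bsub>G\<^esub> 0 = c * act w1 f1 \<one>\<^bsub>G\<^esub> 0 + d * act w1 f2 \<one>\<^bsub>G\<^esub> 0"
      if "\<And>g m. g \<in> carrier G \<Longrightarrow> m < n \<Longrightarrow> f0 g m = c * f1 g m + d * f2 g m" for f0 f1 f2 c d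
      using act_combination[OF w(1) that] n_gt_1 by simp
    from r show "lin_ext (*) ?F (Poly_Mapping.single w1 c1 * r * Poly_Mapping.single w2 c2) = 0"
    proof (cases rule: relation_cases)
      case (mult g h)
      have "act w1 (act [Grp g, Grp h] (act w2 f)) \<one>\<^bsub>G\<^esub> 0
          = 1 * act w1 (act [Grp (g \<otimes>\<^bsub>G\<^esub> h)] (act w2 f)) \<one>\<^bsub>G\<^esub> 0
            + 0 * act w1 (act w2 f) \<one>\<^bsub>G\<^esub> 0"
        by (rule comb) (simp only: act_relations(1)[OF mult(1) _ _ mult(2)] mult_1_left
            mult_zero_left add_0_right)
      then show ?thesis
        by (simp add: mult(3) left_diff_distrib right_diff_distrib single_words_mult k.lin_ext_diff
            del: gen_act.simps)
    next
      case one
      have "act w1 (act [Grp \<one>\<^bsub>G\<^esub>] (act w2 f)) \<one>\<^bsub>G\<^esub> 0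
          = 1 * act w1 (act w2 f) \<one>\<^bsub>G\<^esub> 0 + 0 * act w1 (act w2 f) \<one>\<^bsub>G\<^esub> 0"
        by (rule comb) (simp only: act_relations(2)[OF a_carrier] mult_1_left mult_zero_left
            add_0_right)
      then show ?thesis
        by (simp add: one left_diff_distrib right_diff_distrib single_words_mult k.lin_ext_diff
            del: gen_act.simps)
    next
      case pow
      have "act w1 (act (replicate n X) (act w2 f)) \<one>\<^bsub>G\<^esub> 0
          = \<alpha> * act w1 (act (replicate n (Grp a)) (act w2 f)) \<one>\<^bsub>G\<^esub> 0
            + (- \<alpha>) * act w1 (act w2 f) \<one>\<^bsub>G\<^esub> 0"
        by (rule comb) (simp only: act_relations(3)[OF a_carrier] diff_conv_add_uminus
            mult_minus_left)
      moreover have "lin_ext (*) ?F (Poly_Mapping.single w1 c1 * r * Poly_Mapping.single w2 c2)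
          = c1 * c2 * (act w1 (act (replicate n X) (act w2 f)) \<one>\<^bsub>G\<^esub> 0
            - (\<alpha> * act w1 (act (replicate n (Grp a)) (act w2 f)) \<one>\<^bsub>G\<^esub> 0
              - \<alpha> * act w1 (act w2 f) \<one>\<^bsub>G\<^esub> 0))"
        by (simp only: pow left_diff_distrib right_diff_distrib single_words_mult k.lin_ext_diff
            k.lin_ext_single foldr_append foldr.simps id_o o_id append_Nil append_Nil2 o_apply id_apply
            mult_1_left mult_1_right mult.assoc mult.commute mult.left_commute)
      ultimately show ?thesis by simp
    next
      case (comm g)
      have "act w1 (act [X, Grp g] (act w2 f)) \<one>\<^bsub>G\<^esub> 0
          = \<chi> g * act w1 (act [Grp g, X] (act w2 f)) \<one>\<^bsub>G\<^esub> 0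
            + 0 * act w1 (act w2 f) \<one>\<^bsub>G\<^esub> 0"
        by (rule comb) (simp only: act_relations(4)[OF comm(1)] mult_zero_left add_0_right)
      moreover have "lin_ext (*) ?F (Poly_Mapping.single w1 c1 * r * Poly_Mapping.single w2 c2)
          = c1 * c2 * (act w1 (act [X, Grp g] (act w2 f)) \<one>\<^bsub>G\<^esub> 0
            - \<chi> g * act w1 (act [Grp g, X] (act w2 f)) \<one>\<^bsub>G\<^esub> 0)"
        by (simp only: comm(2) left_diff_distrib right_diff_distrib single_words_mult k.lin_ext_diff
            k.lin_ext_single foldr_append foldr.simps id_o o_id append_Nil append_Nil2 o_apply id_apply
            mult_1_left mult_1_right mult.assoc mult.commute mult.left_commute)
      ultimately show ?thesis by (simp del: gen_act.simps)
    qed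
  qed
  define lift where "lift u = (SOME p. p \<in> ?A \<and> ?ev p = u)" for u
  have lift: "lift u \<in> ?A" "?ev (lift u) = u" for u
  proof -
    have "u \<in> ?ev ` ?A" by (simp only: generated UNIV_I)
    then obtain p where "p \<in> ?A \<and> ?ev p = u" by (elim imageE) simp
    from someI[of "\<lambda>p. p \<in> ?A \<and> ?ev p = u", OF this, folded lift_def]
    show "lift u \<in> ?A" "?ev (lift u) = u" by (rule conjunct1, rule conjunct2)
  qed
  define \<phi> where "\<phi> u = lin_ext (*) ?F (lift u)" for u
  have phi_ev: "\<phi> (?ev p) = lin_ext (*) ?F p" if "p \<in> ?A" for p
  proof -
    have "?ev (lift (?ev p) - p) = 0"
      using lift(2) by (simp add: ev lin_ext_diff)
    then show ?thesis
      using kernel[OF free_algebra_diff[OF lift(1) that]] by (simp add: \<phi>_def k.lin_ext_diff)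
  qed
  show thesis
  proof (rule that)
    show "functional \<phi>"
    proof (rule functionalI)
      show "\<phi> (u + v) = \<phi> u + \<phi> v" for u v
        using phi_ev[OF free_algebra_add[OF lift(1)[of u] lift(1)[of v]]] lift(2)
        by (simp add: ev lin_ext_add k.lin_ext_add \<phi>_def)
      show "\<phi> (c *s u) = c * \<phi> u" for c u
        using phi_ev[OF free_algebra_scale[OF lift(1)[of u]]] lift(2)
        by (simp add: ev lin_ext_scalar k.lin_ext_scalar \<phi>_def)
    qed
    fix g m assume g: "g \<in> carrier G" and m: "m < n"
    let ?w = "Grp g # replicate m X"
    have "Poly_Mapping.single ?w 1 \<in> ?A"
      using g by (intro free_algebra_single) (auto simp: rank_one_generators_def)
    from phi_ev[OF this] show "\<phi> (\<iota> g * x ^ m) = f g m"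
      using g m act_X_power[of m g 0 f] by (simp add: ev prod_list_replicate)
  qed
qed

sublocale Gr: group G by (rule group_G)

lemma relation_holds:
  assumes "r \<in> rank_one_relations G \<chi> a \<alpha>"
  shows "lin_ext scale (\<lambda>w. prod_list (map (case_gen \<iota> x) w)) r = 0"
proof -
  have "r \<in> two_sided_ideal (free_algebra gens) (rank_one_relations G \<chi> a \<alpha>)"
    using assms by (rule two_sided_ideal.rel)
  then have "eval_free scale (case_gen \<iota> x) r = 0"
    unfolding relations[symmetric] by simp
  then show ?thesis by (simp add: eval_free_def lin_ext_def)
qed

lemma iota_mult: "g \<in> carrier G \<Longrightarrow> h \<in> carrier G \<Longrightarrow> \<iota> g * \<iota> h = \<iota> (g \<otimes>\<^bsub>G\<^esub> h)"
proof -
  assume "g \<in> carrier G" "h \<in> carrier G"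
  then have "letter (Grp g) * letter (Grp h) - letter (Grp (g \<otimes>\<^bsub>G\<^esub> h)) \<in> rank_one_relations G \<chi> a \<alpha>"
    unfolding rank_one_relations_def Let_def by blast
  from relation_holds[OF this] show ?thesis
    by (simp add: letter_def single_words_mult lin_ext_diff)
qed

lemma iota_one [simp]: "\<iota> \<one>\<^bsub>G\<^esub> = 1"
proof -
  have "letter (Grp \<one>\<^bsub>G\<^esub>) - 1 \<in> rank_one_relations G \<chi> a \<alpha>"
    unfolding rank_one_relations_def Let_def by blast
  from relation_holds[OF this] show ?thesis
    by (simp add: letter_def one_eq_single_Nil lin_ext_diff)
qed

lemma x_power_n: "x ^ n = \<alpha> *s (\<iota> a ^ n - 1)"
proof -
  have "letter X ^ n - scalar \<alpha> * (letter (Grp a) ^ n - 1) \<in> rank_one_relations G \<chi> a \<alpha>"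
    unfolding rank_one_relations_def Let_def n_def by blast
  from relation_holds[OF this] show ?thesis
    by (simp add: letter_power scalar_def one_eq_single_Nil single_words_mult right_diff_distrib
        lin_ext_diff prod_list_replicate scale_right_diff_distrib)
qed

lemma x_iota: "g \<in> carrier G \<Longrightarrow> x * \<iota> g = \<chi> g *s (\<iota> g * x)"
proof -
  assume "g \<in> carrier G"
  then have "letter X * letter (Grp g) - scalar (\<chi> g) * letter (Grp g) * letter X
      \<in> rank_one_relations G \<chi> a \<alpha>"
    unfolding rank_one_relations_def Let_def by blast
  from relation_holds[OF this] show ?thesis
    by (simp add: letter_def scalar_def single_words_mult lin_ext_diff)
qed

lemma iota_power: "g \<in> carrier G \<Longrightarrow> \<iota> g ^ m = \<iota> (g [^]\<^bsub>G\<^esub> m)"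
  by (induction m) (simp_all add: iota_mult power_Suc2 del: power_Suc)

lemma x_power_iota: "g \<in> carrier G \<Longrightarrow> x ^ m * \<iota> g = \<chi> g ^ m *s (\<iota> g * x ^ m)"
proof (induction m)
  case (Suc m)
  have "x ^ Suc m * \<iota> g = x ^ m * (x * \<iota> g)" by (simp add: power_Suc2 mult.assoc del: power_Suc)
  also have "\<dots> = \<chi> g *s ((x ^ m * \<iota> g) * x)"
    using Suc.prems by (simp add: x_iota scale_mult_right mult.assoc)
  also have "\<dots> = \<chi> g ^ Suc m *s (\<iota> g * x ^ Suc m)"
    using Suc by (simp add: scale_mult_left mult.assoc power_Suc2 del: power_Suc)
  finally show ?case .
qed simp

abbreviation Mon :: "'h set" where "Mon \<equiv> monomials G n \<iota> x"

lemma MonI: "g \<in> carrier G \<Longrightarrow> m < n \<Longrightarrow> \<iota> g * x ^ m \<in> Mon"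
  by (auto simp: monomials_def)

lemma iota_in_span: "g \<in> carrier G \<Longrightarrow> \<iota> g \<in> span Mon"
  using span_base[OF MonI[of g 0]] n_gt_1 by simp

text \<open>The span is stable under left multiplication by the generators: \<open>x g x\<^sup>m = \<chi>(g) g x\<^bsup>m+1\<^esup>\<close>,
  where \<open>x\<^sup>n\<close> is a combination of group elements.\<close>

lemma span_Mon: "span Mon = UNIV"
proof -
  have gen: "case_gen \<iota> x s * u \<in> span Mon" if s: "s \<in> gens" and "u \<in> span Mon" for s u
    using that(2)
  proof (induction rule: span_induct)
    case base
    show ?case
      by (rule subspaceI)
        (simp_all add: span_zero span_add span_scale distrib_left scale_mult_right)
  next
    case (step u)
    then obtain g m where u: "u = \<iota> g * x ^ m" "g \<in> carrier G" "m < n"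
      by (auto simp: monomials_def)
    from s show ?case
    proof (cases rule: gens_cases)
      case 1
      have eq: "x * u = \<chi> g *s (\<iota> g * x ^ Suc m)"
        by (simp add: u x_iota scale_mult_left mult.assoc flip: mult.assoc[of x])
      show ?thesis
      proof (cases "Suc m < n")
        case True
        then show ?thesis
          using 1 eq u(2) span_scale[OF span_base[OF MonI[of g "Suc m"]]] by simp
      next
        case False
        then have "\<iota> g * x ^ Suc m = \<alpha> *s (\<iota> (g \<otimes>\<^bsub>G\<^esub> a [^]\<^bsub>G\<^esub> n) - \<iota> g)"
          using u x_power_n
          by (metis Gr.nat_pow_closed Suc_lessI a_carrier iota_mult iota_power mult.right_neutral
              right_diff_distrib scale_mult_right)
        then show ?thesis using 1 eq u by (simp add: span_scale span_diff iota_in_span)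
      qed
    next
      case (2 h)
      have "\<iota> h * u = \<iota> (h \<otimes>\<^bsub>G\<^esub> g) * x ^ m"
        using u 2 by (simp add: iota_mult flip: mult.assoc)
      then show ?thesis using 2 u by (simp add: MonI span_base)
    qed
  qed
  have word: "prod_list (map (case_gen \<iota> x) w) \<in> span Mon" if "set w \<subseteq> gens" for w
    using that
  proof (induction w)
    case Nil
    then show ?case using iota_in_span[of "\<one>\<^bsub>G\<^esub>"] by simp
  qed (simp add: gen)
  have "u \<in> span Mon" for u
  proof -
    have "u \<in> eval_free scale (case_gen \<iota> x) ` free_algebra gens"
      by (simp only: generated UNIV_I)
    then show ?thesis
      by (auto simp: eval_free_def free_algebra_def intro!: span_sum span_scale word)
  qed
  then show ?thesis by blast
qed

lemma monomial_induct [case_names add scale monomial]: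
  assumes "\<And>u v. P u \<Longrightarrow> P v \<Longrightarrow> P (u + v)" "\<And>c u. P u \<Longrightarrow> P (c *s u)"
    and "\<And>g m. g \<in> carrier G \<Longrightarrow> m < n \<Longrightarrow> P (\<iota> g * x ^ m)"
  shows "P u"
proof -
  have "u \<in> span Mon" by (simp add: span_Mon)
  then show ?thesis
  proof (induction rule: span_induct)
    case base
    have "P 0" using assms(2)[OF assms(3)[of "\<one>\<^bsub>G\<^esub>" 0], of 0] n_gt_1 by simp
    then show ?case by (intro subspaceI) (auto intro: assms(1,2))
  next
    case (step u)
    then show ?case using assms(3) by (auto simp: monomials_def)
  qed
qed

lemma monomials_inj:
  assumes "\<iota> g * x ^ m = \<iota> h * x ^ j" "g \<in> carrier G" "h \<in> carrier G" "m < n" "j < n"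
  shows "g = h \<and> m = j"
proof -
  obtain \<phi> where phi: "functional \<phi>" "\<And>g' m'. g' \<in> carrier G \<Longrightarrow> m' < n \<Longrightarrow>
      \<phi> (\<iota> g' * x ^ m') = (if g' = g \<and> m' = m then 1 else 0)"
    by (rule functional_exists[of "\<lambda>g' m'. if g' = g \<and> m' = m then 1 else 0"]) (rule that)
  have "(1 :: 'k) = (if h = g \<and> j = m then 1 else 0)"
    using phi(2)[of g m] phi(2)[of h j] assms by simp
  then show ?thesis by (auto split: if_splits)
qed

lemma independent_Mon: "independent Mon"
proof (rule independent_if_scalars_zero)
  have "Mon \<subseteq> (\<lambda>(g, m). \<iota> g * x ^ m) ` (carrier G \<times> {..<n})"
    by (auto simp: monomials_def)
  then show fin: "finite Mon" by (rule finite_subset) simp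
  fix c v assume sum: "(\<Sum>v\<in>Mon. c v *s v) = 0" and "v \<in> Mon"
  then obtain g m where v: "v = \<iota> g * x ^ m" "g \<in> carrier G" "m < n"
    by (auto simp: monomials_def)
  obtain \<phi> where lin: "functional \<phi>" and phi: "\<And>g' m'. g' \<in> carrier G \<Longrightarrow> m' < n \<Longrightarrow>
      \<phi> (\<iota> g' * x ^ m') = (if g' = g \<and> m' = m then 1 else 0)"
    by (rule functional_exists[of "\<lambda>g' m'. if g' = g \<and> m' = m then 1 else 0"]) (rule that)
  have "\<phi> w = (if w = v then 1 else 0)" if "w \<in> Mon" for w
    using that phi monomials_inj v by (auto simp: monomials_def)
  then have "\<phi> (\<Sum>v\<in>Mon. c v *s v) = (\<Sum>w\<in>Mon. c w * (if w = v then 1 else 0))"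
    by (simp add: functional_sum[OF lin] functional_scale[OF lin])
  also have "\<dots> = (\<Sum>w\<in>Mon. if w = v then c v else 0)"
    by (intro sum.cong) auto
  also have "\<dots> = c v"
    using \<open>v \<in> Mon\<close> fin by simp
  finally show "c v = 0"
    using sum functional_0[OF lin] by simp
qed

definition coef :: "'g \<Rightarrow> nat \<Rightarrow> 'h \<Rightarrow> 'k" where
  "coef g m u = representation Mon u (\<iota> g * x ^ m)"

lemma functional_coef: "functional (coef g m)"
  by (rule functionalI)
    (simp_all add: coef_def representation_add representation_scale independent_Mon span_Mon)

lemmas coef_simps =
  functional_0[OF functional_coef] functional_add[OF functional_coef]
  functional_scale[OF functional_coef] functional_diff[OF functional_coef]
  functional_sum[OF functional_coef]

lemma coef_monomial:
  "g \<in> carrier G \<Longrightarrow> h \<in> carrier G \<Longrightarrow> m < n \<Longrightarrow> j < n \<Longrightarrow>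
     coef g m (\<iota> h * x ^ j) = (if g = h \<and> m = j then 1 else 0)"
  using monomials_inj[of g m h j]
  by (auto simp: coef_def representation_basis independent_Mon MonI)

lemma coef_iota:
  "g \<in> carrier G \<Longrightarrow> h \<in> carrier G \<Longrightarrow> m < n \<Longrightarrow> coef g m (\<iota> h) = (if g = h \<and> m = 0 then 1 else 0)"
  using coef_monomial[of g h m 0] n_gt_1 by simp

lemma coef_x:
  "g \<in> carrier G \<Longrightarrow> m < n \<Longrightarrow> coef g m x = (if g = \<one>\<^bsub>G\<^esub> \<and> m = 1 then 1 else 0)"
  using coef_monomial[of g "\<one>\<^bsub>G\<^esub>" m 1] n_gt_1 by simp

lemma monomial_expansion: "(\<Sum>g\<in>carrier G. \<Sum>m<n. coef g m u *s (\<iota> g * x ^ m)) = u"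
proof (induction u rule: monomial_induct)
  case (add u v)
  then show ?case by (simp add: coef_simps scale_left_distrib sum.distrib)
next
  case (scale c u)
  have "(\<Sum>g\<in>carrier G. \<Sum>m<n. coef g m (c *s u) *s (\<iota> g * x ^ m))
      = c *s (\<Sum>g\<in>carrier G. \<Sum>m<n. coef g m u *s (\<iota> g * x ^ m))"
    by (simp add: coef_simps scale_sum_right)
  then show ?case by (simp only: scale)
next
  case (monomial h j)
  have "(\<Sum>m<n. coef g m (\<iota> h * x ^ j) *s (\<iota> g * x ^ m)) = (if g = h then \<iota> h * x ^ j else 0)"
    if "g \<in> carrier G" for g
  proof -
    have "(\<Sum>m<n. coef g m (\<iota> h * x ^ j) *s (\<iota> g * x ^ m))
        = (\<Sum>m<n. if m = j then if g = h then \<iota> h * x ^ j else 0 else 0)"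
      using monomial that by (intro sum.cong) (auto simp: coef_monomial)
    then show ?thesis using monomial by simp
  qed
  then show ?case using monomial by simp
qed

lemma coef_ext:
  assumes "\<And>g m. g \<in> carrier G \<Longrightarrow> m < n \<Longrightarrow> coef g m u = coef g m v"
  shows "u = v"
proof -
  have "(\<Sum>g\<in>carrier G. \<Sum>m<n. coef g m u *s (\<iota> g * x ^ m))
      = (\<Sum>g\<in>carrier G. \<Sum>m<n. coef g m v *s (\<iota> g * x ^ m))"
    using assms by (intro sum.cong) simp_all
  then show ?thesis by (simp only: monomial_expansion)
qed

lemma iota_eq_iff: "g \<in> carrier G \<Longrightarrow> h \<in> carrier G \<Longrightarrow> \<iota> g = \<iota> h \<longleftrightarrow> g = h"
  using monomials_inj[of g 0 h 0] n_gt_1 by auto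

lemma iota_nonzero: "g \<in> carrier G \<Longrightarrow> \<iota> g \<noteq> 0"
  using coef_iota[of g g 0] n_gt_1 by (auto simp: coef_simps)

lemma a_not_one: "a \<noteq> \<one>\<^bsub>G\<^esub>"
  using chi_a_power_less[of 1] n_gt_1 chi_one by auto

lemma coef_one: "g \<in> carrier G \<Longrightarrow> m < n \<Longrightarrow> coef g m 1 = (if g = \<one>\<^bsub>G\<^esub> \<and> m = 0 then 1 else 0)"
  using coef_iota[of g "\<one>\<^bsub>G\<^esub>" m] by simp

section \<open>Grouplike and skew-primitive elements\<close>

lemma sweedler_iota: "g \<in> carrier G \<Longrightarrow> bilin f \<Longrightarrow> sweedler f (\<iota> g) = f (\<iota> g) (\<iota> g)"
  using sweedler_eqI[OF _ comult_group] by simp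

lemma sweedler_x: "bilin f \<Longrightarrow> sweedler f x = f x (\<iota> a) + f 1 x"
  using sweedler_eqI[OF _ comult_x] by simp

lemma counit_iota: "g \<in> carrier G \<Longrightarrow> \<epsilon> (\<iota> g) = 1"
proof -
  assume g: "g \<in> carrier G"
  have "\<epsilon> (\<iota> g) *s \<iota> g = \<iota> g"
    using sweedler_counit_left[OF lin_id] sweedler_iota[OF g bilin_slice_left[OF functional_counit]]
    by metis
  then have "(\<epsilon> (\<iota> g) - 1) *s \<iota> g = 0" by (simp add: scale_left_diff_distrib)
  then show ?thesis using iota_nonzero[OF g] by simp
qed

lemma counit_x: "\<epsilon> x = 0"
proof -
  have "\<epsilon> x *s \<iota> a + \<epsilon> 1 *s x = x"
    using sweedler_counit_left[OF lin_id] sweedler_x[OF bilin_slice_left[OF functional_counit]]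
    by metis
  then show ?thesis using iota_nonzero[OF a_carrier] by (simp add: counit_one)
qed

lemma counit_monomial: "g \<in> carrier G \<Longrightarrow> \<epsilon> (\<iota> g * x ^ m) = (if m = 0 then 1 else 0)"
  by (cases m) (simp_all add: counit_mult counit_iota counit_x)

lemma skew_primitive_x: "skew_primitive (\<iota> a) x"
  by (simp add: skew_primitive_def sweedler_x)

definition deg1 :: "'h \<Rightarrow> 'k" where "deg1 u = (\<Sum>g\<in>carrier G. coef g 1 u)"

lemma functional_deg1: "functional deg1"
  by (rule functionalI) (simp_all add: deg1_def coef_simps sum.distrib sum_distrib_left)

lemmas deg1_simps =
  functional_0[OF functional_deg1] functional_add[OF functional_deg1]
  functional_scale[OF functional_deg1] functional_diff[OF functional_deg1]

lemma deg1_monomial: "g \<in> carrier G \<Longrightarrow> m < n \<Longrightarrow> deg1 (\<iota> g * x ^ m) = (if m = 1 then 1 else 0)"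
  using n_gt_1 by (simp add: deg1_def coef_monomial)

lemma deg1_iota: "g \<in> carrier G \<Longrightarrow> deg1 (\<iota> g) = 0"
  using deg1_monomial[of g 0] n_gt_1 by simp

lemma deg1_one: "deg1 1 = 0"
  using deg1_iota[of "\<one>\<^bsub>G\<^esub>"] by simp

lemma deg1_x: "deg1 x = 1"
  using deg1_monomial[of "\<one>\<^bsub>G\<^esub>" 1] n_gt_1 by simp

text \<open>Multiplication by \<open>x\<close> reaches degree 1 only from degree 0: the product \<open>g x\<^bsup>n-1\<^esup> x\<close> lies in
  the group algebra, and \<open>n > 1\<close>.\<close>

lemma deg1_mult_x: "deg1 (u * x) = \<epsilon> u"
proof (induction u rule: monomial_induct)
  case (monomial g m)
  show ?case
  proof (cases "Suc m < n")
    case True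
    then show ?thesis
      using monomial deg1_monomial[of g "Suc m"]
      by (simp add: mult.assoc counit_monomial power_Suc2 del: power_Suc)
  next
    case False
    then have m: "Suc m = n" "m \<noteq> 0" using monomial n_gt_1 by auto
    have "\<iota> g * x ^ m * x = \<iota> g * x ^ n"
      by (simp add: mult.assoc flip: power_Suc2 m(1))
    also have "\<dots> = \<alpha> *s (\<iota> (g \<otimes>\<^bsub>G\<^esub> a [^]\<^bsub>G\<^esub> n) - \<iota> g)"
      using monomial
      by (simp add: x_power_n scale_mult_right right_diff_distrib iota_power iota_mult)
    finally have "deg1 (\<iota> g * x ^ m * x) = 0"
      using monomial by (simp add: deg1_simps deg1_iota)
    then show ?thesis using monomial m by (simp add: counit_monomial)
  qed
qed (simp_all add: distrib_right scale_mult_left deg1_simps functional_add[OF functional_counit]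
    functional_scale[OF functional_counit])

lemma deg1_mult_a: "deg1 (u * \<iota> a) = \<chi> a * deg1 u"
proof (induction u rule: monomial_induct)
  case (monomial g m)
  have "\<iota> g * x ^ m * \<iota> a = \<chi> a ^ m *s (\<iota> (g \<otimes>\<^bsub>G\<^esub> a) * x ^ m)"
    using monomial by (simp add: mult.assoc x_power_iota scale_mult_right flip: iota_mult)
  then show ?case using monomial by (simp add: deg1_simps deg1_monomial)
qed (simp_all add: distrib_right scale_mult_left deg1_simps distrib_left)

text \<open>Contracting one factor of the coproduct with the degree-one form gives two versions of
  \<open>q\<close>-differentiation by \<open>x\<close>, where \<open>q = \<chi> a\<close>. They send \<open>g x\<^sup>m\<close> to a multiple of a monomial of degree
  \<open>m - 1\<close> by the \<open>q\<close>-integer \<open>1 + q + \<dots> + q\<^bsup>m-1\<^esup>\<close>, which is nonzero for \<open>0 < m < n\<close> because \<open>q\<close>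
  has order \<open>n\<close>. So they replace the \<open>q\<close>-binomial formula for the coproduct of \<open>g x\<^sup>m\<close>.\<close>

definition left_der :: "'h \<Rightarrow> 'h" where "left_der = sweedler (\<lambda>p q. deg1 p *s q)"
definition right_der :: "'h \<Rightarrow> 'h" where "right_der = sweedler (\<lambda>p q. deg1 q *s p)"

lemma lin_left_der: "lin left_der" and lin_right_der: "lin right_der"
  unfolding left_der_def right_der_def
  by (intro lin_sweedler bilin_slice_left bilin_slice_right functional_deg1)+

lemma sweedler_mult_x:
  "bilin f \<Longrightarrow> sweedler f (u * x) = sweedler (\<lambda>p q. f (p * x) (q * \<iota> a) + f p (q * x)) u"
proof -
  assume f: "bilin f"
  have "bilin (\<lambda>v1 v2. f (p * v1) (q * v2))" for p q
    by (intro bilinI bilin_lin[OF f] lin_mult_left lin_id)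
  then show ?thesis by (simp add: sweedler_mult[OF f] sweedler_x)
qed

lemma left_der_mult_x: "left_der (u * x) = u * \<iota> a + left_der u * x"
proof -
  have "left_der (u * x) = sweedler (\<lambda>p q. \<epsilon> p *s (q * \<iota> a) + deg1 p *s (q * x)) u"
    by (simp add: left_der_def sweedler_mult_x bilin_slice_left functional_deg1 deg1_mult_x)
  also have "\<dots> = u * \<iota> a + sweedler (\<lambda>p q. (deg1 p *s q) * x) u"
    by (simp add: sweedler_add sweedler_counit_left lin_mult_right lin_id scale_mult_left)
  also have "sweedler (\<lambda>p q. (deg1 p *s q) * x) u = left_der u * x"
    unfolding left_der_def
    by (rule lin_sweedler_commute[of "\<lambda>u. u * x", symmetric]) (intro lin_mult_right lin_id)
  finally show ?thesis .
qed

lemma right_der_mult_x: "right_der (u * x) = u + \<chi> a *s (right_der u * x)"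
proof -
  have "right_der (u * x) = sweedler (\<lambda>p q. \<epsilon> q *s p + (\<chi> a * deg1 q) *s (p * x)) u"
    by (simp add: right_der_def sweedler_mult_x bilin_slice_right functional_deg1 deg1_mult_x
        deg1_mult_a add.commute)
  also have "\<dots> = u + sweedler (\<lambda>p q. \<chi> a *s ((deg1 q *s p) * x)) u"
    by (simp add: sweedler_add sweedler_counit_right lin_id scale_mult_left)
  also have "sweedler (\<lambda>p q. \<chi> a *s ((deg1 q *s p) * x)) u = \<chi> a *s (right_der u * x)"
    unfolding right_der_def
    by (rule lin_sweedler_commute[of "\<lambda>u. \<chi> a *s (u * x)", symmetric])
      (intro lin_scale_const lin_mult_right lin_id)
  finally show ?thesis .
qed

definition q_int :: "nat \<Rightarrow> 'k" where "q_int m = (\<Sum>i<m. \<chi> a ^ i)"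

lemma q_int_Suc: "q_int (Suc m) = q_int m + \<chi> a ^ m" "q_int (Suc m) = 1 + \<chi> a * q_int m"
  by (simp add: q_int_def)
    (simp add: q_int_def sum.lessThan_Suc_shift sum_distrib_left del: sum.lessThan_Suc)

lemma q_int_0: "q_int 0 = 0"
  by (simp add: q_int_def)

lemma q_int_nonzero: "0 < m \<Longrightarrow> m < n \<Longrightarrow> q_int m \<noteq> 0"
  using power_diff_1_eq[of "\<chi> a" m] chi_a_power_less[of m] by (auto simp: q_int_def)

lemma left_der_monomial:
  "g \<in> carrier G \<Longrightarrow> left_der (\<iota> g * x ^ m) = q_int m *s (\<iota> (g \<otimes>\<^bsub>G\<^esub> a) * x ^ (m - 1))"
proof (induction m)
  case 0
  then show ?case
    by (simp add: left_der_def sweedler_iota bilin_slice_left functional_deg1 deg1_iota q_int_def)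
next
  case (Suc m)
  have "left_der (\<iota> g * x ^ Suc m) = \<iota> g * x ^ m * \<iota> a + left_der (\<iota> g * x ^ m) * x"
    using left_der_mult_x[of "\<iota> g * x ^ m"] by (simp add: mult.assoc power_Suc2 del: power_Suc)
  also have "\<iota> g * x ^ m * \<iota> a = \<chi> a ^ m *s (\<iota> (g \<otimes>\<^bsub>G\<^esub> a) * x ^ m)"
    using Suc.prems by (simp add: mult.assoc x_power_iota scale_mult_right flip: iota_mult)
  also have "left_der (\<iota> g * x ^ m) * x = q_int m *s (\<iota> (g \<otimes>\<^bsub>G\<^esub> a) * x ^ m)"
    using Suc by (cases m) (simp_all add: q_int_def scale_mult_left mult.assoc flip: power_Suc2)
  finally show ?case by (simp add: q_int_Suc(1) scale_left_distrib add.commute)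
qed

lemma right_der_monomial:
  "g \<in> carrier G \<Longrightarrow> right_der (\<iota> g * x ^ m) = q_int m *s (\<iota> g * x ^ (m - 1))"
proof (induction m)
  case 0
  then show ?case
    by (simp add: right_der_def sweedler_iota bilin_slice_right functional_deg1 deg1_iota q_int_def)
next
  case (Suc m)
  have "right_der (\<iota> g * x ^ Suc m) = \<iota> g * x ^ m + \<chi> a *s (right_der (\<iota> g * x ^ m) * x)"
    using right_der_mult_x[of "\<iota> g * x ^ m"] by (simp add: mult.assoc power_Suc2 del: power_Suc)
  also have "right_der (\<iota> g * x ^ m) * x = q_int m *s (\<iota> g * x ^ m)"
    using Suc by (cases m) (simp_all add: q_int_def scale_mult_left mult.assoc flip: power_Suc2)
  finally show ?case by (simp add: q_int_Suc(2) scale_left_distrib)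
qed

lemma coef_left_der:
  assumes "g \<in> carrier G" "m < n"
  shows "coef (g \<otimes>\<^bsub>G\<^esub> a) m (left_der u) = (if Suc m < n then q_int (Suc m) * coef g (Suc m) u else 0)"
proof (induction u rule: monomial_induct)
  case (monomial h j)
  have "coef (g \<otimes>\<^bsub>G\<^esub> a) m (left_der (\<iota> h * x ^ j)) = q_int j * (if g = h \<and> m = j - 1 then 1 else 0)"
    using monomial assms by (simp add: left_der_monomial coef_simps coef_monomial)
  then show ?case
    using monomial assms
    by (cases j) (auto simp: q_int_0 coef_monomial coef_iota simp del: power_Suc)
qed (simp_all add: lin_add[OF lin_left_der] lin_scale[OF lin_left_der] coef_simps algebra_simps)

lemma coef_right_der:
  assumes "g \<in> carrier G" "m < n"
  shows "coef g m (right_der u) = (if Suc m < n then q_int (Suc m) * coef g (Suc m) u else 0)"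
proof (induction u rule: monomial_induct)
  case (monomial h j)
  have "coef g m (right_der (\<iota> h * x ^ j)) = q_int j * (if g = h \<and> m = j - 1 then 1 else 0)"
    using monomial assms by (simp add: right_der_monomial coef_simps coef_monomial)
  then show ?case
    using monomial assms
    by (cases j) (auto simp: q_int_0 coef_monomial coef_iota simp del: power_Suc)
qed (simp_all add: lin_add[OF lin_right_der] lin_scale[OF lin_right_der] coef_simps algebra_simps)

text \<open>The kernel of \<open>q\<close>-differentiation consists of the constants, that is, of the group algebra.\<close>

lemma left_der_zero_imp_group_part:
  assumes "left_der u = 0"
  shows "u = (\<Sum>g\<in>carrier G. coef g 0 u *s \<iota> g)"
proof (rule coef_ext)
  fix g m assume g: "g \<in> carrier G" and m: "m < n"
  have "coef g m u = 0" if "m \<noteq> 0"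
  proof -
    obtain j where "m = Suc j" using \<open>m \<noteq> 0\<close> not0_implies_Suc by blast
    then show ?thesis
      using coef_left_der[OF g, of j u] assms m q_int_nonzero[of m] by (simp add: coef_simps)
  qed
  then show "coef g m u = coef g m (\<Sum>g\<in>carrier G. coef g 0 u *s \<iota> g)"
    using g m by (cases "m = 0") (auto simp: coef_simps coef_iota if_distrib cong: if_cong)
qed

lemma sweedler_group_part:
  assumes "bilin f" "left_der u = 0"
  shows "sweedler f u = (\<Sum>g\<in>carrier G. coef g 0 u *s f (\<iota> g) (\<iota> g))"
proof -
  have "sweedler f u = sweedler f (\<Sum>g\<in>carrier G. coef g 0 u *s \<iota> g)"
    by (rule arg_cong[OF left_der_zero_imp_group_part[OF assms(2)]])
  also have "\<dots> = (\<Sum>g\<in>carrier G. coef g 0 u *s f (\<iota> g) (\<iota> g))"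
    using assms(1)
    by (simp add: lin_sum[OF lin_sweedler] lin_scale[OF lin_sweedler] sweedler_iota)
  finally show ?thesis .
qed

lemma sweedler_coef_slice:
  assumes "left_der u = 0" "g \<in> carrier G"
  shows "sweedler (\<lambda>p q. coef g 0 p *s q) u = coef g 0 u *s \<iota> g"
proof -
  have "sweedler (\<lambda>p q. coef g 0 p *s q) u
      = (\<Sum>h\<in>carrier G. coef h 0 u *s (coef g 0 (\<iota> h) *s \<iota> h))"
    by (rule sweedler_group_part) (simp_all add: assms(1) bilin_slice_left functional_coef)
  also have "\<dots> = (\<Sum>h\<in>carrier G. if h = g then coef g 0 u *s \<iota> g else 0)"
    using assms(2) n_gt_1 by (intro sum.cong) (auto simp: coef_iota)
  finally show ?thesis using assms(2) by simp
qed

text \<open>A grouplike \<open>u\<close> is an eigenvector of \<^const>\<open>left_der\<close>. As this operator lowers degrees, the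
  eigenvalue is zero, so \<open>u\<close> lies in the group algebra. There grouplike elements are group elements
  because distinct group elements are linearly independent.\<close>

lemma grouplike_imp_iota:
  assumes "grouplike u"
  obtains g where "g \<in> carrier G" "u = \<iota> g"
proof -
  have sw: "sweedler f u = f u u" if "bilin f" for f
    using assms that by (simp add: grouplike_def)
  have nz: "u \<noteq> 0"
    using assms functional_0[OF functional_counit] by (auto simp: grouplike_def)
  have der: "left_der u = deg1 u *s u"
    by (simp add: left_der_def sw bilin_slice_left functional_deg1)
  have deg: "deg1 u = 0"
  proof (rule ccontr)
    assume c: "deg1 u \<noteq> 0"
    have step: "deg1 u * coef g m u
        = (if Suc m < n then q_int (Suc m) * coef (g \<otimes>\<^bsub>G\<^esub> inv\<^bsub>G\<^esub> a) (Suc m) u else 0)"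
      if "g \<in> carrier G" "m < n" for g m
      using coef_left_der[of "g \<otimes>\<^bsub>G\<^esub> inv\<^bsub>G\<^esub> a" m u] that
      by (simp add: der coef_simps Gr.m_assoc)
    \<comment> \<open>A nonzero eigenvalue would make each coefficient a multiple of one in the next higher degree.\<close>
    have "coef g m u = 0" if "g \<in> carrier G" "m < n" for g m
      using that
    proof (induction "n - m" arbitrary: g m rule: less_induct)
      case less
      show ?case
      proof (cases "Suc m < n")
        case True
        then have "coef (g \<otimes>\<^bsub>G\<^esub> inv\<^bsub>G\<^esub> a) (Suc m) u = 0"
          using less by (intro less(1)) auto
        then show ?thesis using step[OF less(2,3)] c True by simp
      next
        case False
        then show ?thesis using step[OF less(2,3)] c by simp
      qed
    qed
    then have "u = 0" by (intro coef_ext) (simp add: coef_simps)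
    then show False using nz by simp
  qed
  then have der0: "left_der u = 0" using der by simp
  obtain g where g: "g \<in> carrier G" "coef g 0 u \<noteq> 0"
  proof (rule ccontr)
    assume "\<not> thesis"
    then have "\<And>g. g \<in> carrier G \<Longrightarrow> coef g 0 u = 0" using that by blast
    then have "(\<Sum>g\<in>carrier G. coef g 0 u *s \<iota> g) = 0" by simp
    with left_der_zero_imp_group_part[OF der0] nz show False by metis
  qed
  have "coef g 0 u *s \<iota> g = coef g 0 u *s u"
    by (rule trans[OF sweedler_coef_slice[OF der0 g(1), symmetric]
          sw[OF bilin_slice_left[OF functional_coef]]])
  then have "u = \<iota> g" using g(2) by simp
  with g(1) show thesis by (rule that)
qed

lemma skew_primitive_diff:
  assumes "skew_primitive b u" "skew_primitive b v"
  shows "skew_primitive b (u - c *s v)"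
  unfolding skew_primitive_def
proof (intro allI impI)
  fix f assume f: "bilin f"
  then have l: "lin (\<lambda>u. f u b)" "lin (f 1)" by (simp_all add: bilin_def)
  show "sweedler f (u - c *s v) = f (u - c *s v) b + f 1 (u - c *s v)"
    using assms f
    by (simp add: skew_primitive_def lin_diff[OF lin_sweedler] lin_scale[OF lin_sweedler]
        lin_diff[OF l(1)] lin_scale[OF l(1)] lin_diff[OF l(2)] lin_scale[OF l(2)] scale_right_distrib)
qed

text \<open>If \<open>u\<close> is \<open>(1, h)\<close>-skew-primitive and \<open>d\<close> is the value of \<^const>\<open>deg1\<close> at it, the two derivatives of
  \<open>u\<close> are \<open>d h\<close> and \<open>d 1\<close>. The first one makes \<open>d\<close> the coefficient of \<open>u\<close> at \<open>h a\<^sup>-\<^sup>1 x\<close>, the second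
  one makes it the coefficient at \<open>x\<close>, so \<open>d \<noteq> 0\<close> forces \<open>h = a\<close>. After subtraction of \<open>d x\<close>
  an element of the group algebra remains.\<close>

lemma skew_primitive_cases:
  assumes u: "skew_primitive (\<iota> h) u" and h: "h \<in> carrier G"
  obtains (trivial) d where "u = d *s (1 - \<iota> h)"
  | (nontrivial) c d where "h = a" "c \<noteq> 0" "u = c *s x + d *s (1 - \<iota> a)"
proof -
  have left: "left_der v = deg1 v *s \<iota> h" and right: "right_der v = deg1 v *s 1"
    if "skew_primitive (\<iota> h) v" for v
    using that h by (simp_all add: left_der_def right_der_def skew_primitive_def bilin_slice_left
        bilin_slice_right functional_deg1 deg1_one deg1_iota)
  have group_part: "v = coef \<one>\<^bsub>G\<^esub> 0 v *s (1 - \<iota> h)"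
    if v: "skew_primitive (\<iota> h) v" and "left_der v = 0" for v
  proof -
    have "sweedler (\<lambda>p q. coef \<one>\<^bsub>G\<^esub> 0 p *s q) v
        = coef \<one>\<^bsub>G\<^esub> 0 v *s \<iota> h + coef \<one>\<^bsub>G\<^esub> 0 1 *s v"
      using v by (simp add: skew_primitive_def bilin_slice_left functional_coef)
    also have "coef \<one>\<^bsub>G\<^esub> 0 1 = 1"
      using coef_iota[of "\<one>\<^bsub>G\<^esub>" "\<one>\<^bsub>G\<^esub>" 0] n_gt_1 by simp
    finally have "coef \<one>\<^bsub>G\<^esub> 0 v *s 1 = coef \<one>\<^bsub>G\<^esub> 0 v *s \<iota> h + v"
      using sweedler_coef_slice[OF that(2), of "\<one>\<^bsub>G\<^esub>"] by simp
    then show ?thesis by (simp only: scale_right_diff_distrib) (simp only: add_diff_cancel_left')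
  qed
  show thesis
  proof (cases "deg1 u = 0")
    case True
    then have "left_der u = 0" by (simp add: left[OF u])
    from group_part[OF u this] show ?thesis by (rule trivial)
  next
    case False
    let ?g = "h \<otimes>\<^bsub>G\<^esub> inv\<^bsub>G\<^esub> a"
    have g: "?g \<in> carrier G" "?g \<otimes>\<^bsub>G\<^esub> a = h"
      using h by (simp_all add: Gr.m_assoc)
    have "coef h 0 (left_der u) = coef ?g 0 (right_der u)"
      using coef_left_der[of ?g 0 u] coef_right_der[of ?g 0 u] g n_gt_1 by simp
    then have "coef ?g 0 (\<iota> \<one>\<^bsub>G\<^esub>) = 1"
      using False h n_gt_1 by (simp add: left[OF u] right[OF u] coef_simps coef_iota)
    then have "?g = \<one>\<^bsub>G\<^esub>"
      using g n_gt_1 by (simp add: coef_iota del: iota_one split: if_splits)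
    then have ha: "h = a" using g by simp
    let ?v = "u - deg1 u *s x"
    have v: "skew_primitive (\<iota> h) ?v"
      using skew_primitive_diff u skew_primitive_x ha by blast
    have "left_der ?v = 0" by (simp add: left[OF v] deg1_simps deg1_x)
    from group_part[OF v this] obtain d where "?v = d *s (1 - \<iota> a)"
      unfolding ha by blast
    then have "u = deg1 u *s x + d *s (1 - \<iota> a)"
      by (simp only: diff_eq_eq add.commute)
    then show ?thesis by (rule nontrivial[OF ha False])
  qed
qed

end

section \<open>The coproducts of the two operations\<close>

context q_magma_coalgebra
begin

lemma lin_dot_left: "lin f \<Longrightarrow> lin (\<lambda>u. f u \<cdot> v)"
  using lin_add[OF dot_linear_left] lin_scale[OF dot_linear_left]
  by (intro linI) (simp_all add: lin_add lin_scale)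

lemma lin_dot_right: "lin f \<Longrightarrow> lin (\<lambda>u. v \<cdot> f u)"
  using lin_add[OF dot_linear_right] lin_scale[OF dot_linear_right]
  by (intro linI) (simp_all add: lin_add lin_scale)

lemma lin_col_left: "lin f \<Longrightarrow> lin (\<lambda>u. f u \<Colon> v)"
  using lin_add[OF col_linear_left] lin_scale[OF col_linear_left]
  by (intro linI) (simp_all add: lin_add lin_scale)

lemma lin_col_right: "lin f \<Longrightarrow> lin (\<lambda>u. v \<Colon> f u)"
  using lin_add[OF col_linear_right] lin_scale[OF col_linear_right]
  by (intro linI) (simp_all add: lin_add lin_scale)

lemma sum_braiding:
  "(\<Sum>(s, t)\<leftarrow>braiding \<Delta> dot col u v. f s t)
     = sweedler (\<lambda>u1 u2. sweedler (\<lambda>v1 v2. f (v1 \<Colon> u2) (u1 \<cdot> v2)) v) u"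
  by (simp add: braiding_def sweedler_def case_prod_unfold map_concat sum_list_concat_map comp_def)

lemma sum_braiding_counit_left:
  assumes g: "lin g"
  shows "(\<Sum>(s, t)\<leftarrow>braiding \<Delta> dot col u v. \<epsilon> s *s g t) = g (u \<cdot> v)"
proof -
  have g_left: "lin (\<lambda>u. g (u \<cdot> v))" and g_right: "lin (\<lambda>v. g (u \<cdot> v))" for u v
    by (intro lin_compose[OF g] lin_dot_left lin_dot_right lin_id)+
  have "(\<Sum>(s, t)\<leftarrow>braiding \<Delta> dot col u v. \<epsilon> s *s g t)
      = sweedler (\<lambda>u1 u2. sweedler (\<lambda>v1 v2. \<epsilon> v1 *s (\<epsilon> u2 *s g (u1 \<cdot> v2))) v) u"
    by (simp add: sum_braiding counit_col)
  also have "\<dots> = sweedler (\<lambda>u1 u2. \<epsilon> u2 *s g (u1 \<cdot> v)) u"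
    by (simp add: sweedler_counit_left lin_scale_const g_right del: scale_scale)
  also have "\<dots> = g (u \<cdot> v)"
    by (simp add: sweedler_counit_right g_left)
  finally show ?thesis .
qed

lemma sum_braiding_counit_right:
  assumes g: "lin g"
  shows "(\<Sum>(s, t)\<leftarrow>braiding \<Delta> dot col u v. \<epsilon> t *s g s) = g (v \<Colon> u)"
proof -
  have g_left: "lin (\<lambda>u. g (u \<Colon> v))" and g_right: "lin (\<lambda>v. g (u \<Colon> v))" for u v
    by (intro lin_compose[OF g] lin_col_left lin_col_right lin_id)+
  have "(\<Sum>(s, t)\<leftarrow>braiding \<Delta> dot col u v. \<epsilon> t *s g s)
      = sweedler (\<lambda>u1 u2. sweedler (\<lambda>v1 v2. \<epsilon> v2 *s (\<epsilon> u1 *s g (v1 \<Colon> u2))) v) u"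
    by (simp add: sum_braiding counit_dot mult.commute)
  also have "\<dots> = sweedler (\<lambda>u1 u2. \<epsilon> u1 *s g (v \<Colon> u2)) u"
    by (simp add: sweedler_counit_right lin_scale_const g_left del: scale_scale)
  also have "\<dots> = g (v \<Colon> u)"
    by (simp add: sweedler_counit_left g_right)
  finally show ?thesis .
qed

lemma braiding_comult_quad:
  assumes lin: "\<And>q r s. lin (\<lambda>p. F p q r s)" "\<And>p r s. lin (\<lambda>q. F p q r s)"
      "\<And>p q s. lin (\<lambda>r. F p q r s)" "\<And>p q r. lin (\<lambda>s. F p q r s)"
  shows "sweedler (\<lambda>u1 u2. sweedler (\<lambda>v1 v2.
        \<Sum>(s, t)\<leftarrow>braiding \<Delta> dot col u1 v2. \<Sum>(s', t')\<leftarrow>braiding \<Delta> dot col u2 v1. F s t s' t') v) u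
    = (\<Sum>(s, t)\<leftarrow>braiding \<Delta> dot col u v.
        sweedler (\<lambda>s1 s2. sweedler (\<lambda>t1 t2. F s2 t1 s1 t2) t) s)"
proof -
  have quad4: "quad F [p, q, r, s] = F p q r s" for p q r s
    by (simp add: quad_def numeral_eq_Suc)
  show ?thesis
    using tensor_eq_quad[OF lin braiding_comult[where u = u and v = v]]
    by (simp add: sweedler_def case_prod_unfold map_concat sum_list_concat_map comp_def quad4)
qed

text \<open>Contracting two of the four tensor factors of \<open>braiding_comult\<close> with the counit gives the
  coproducts of \<open>u \<cdot> v\<close> and \<open>v \<Colon> u\<close> and the cocommutativity of the braiding.\<close>

lemma comult_dot:
  assumes f: "bilin f"
  shows "sweedler f (u \<cdot> v) = sweedler (\<lambda>u1 u2. sweedler (\<lambda>v1 v2. f (u1 \<cdot> v2) (u2 \<cdot> v1)) v) u"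
proof -
  note f_lin = f[unfolded bilin_def, THEN conjunct1, rule_format]
    f[unfolded bilin_def, THEN conjunct2, rule_format]
  let ?F = "\<lambda>p q r s. \<epsilon> p *s (\<epsilon> r *s f q s)"
  have lin_F: "lin (\<lambda>p. ?F p q r s)" "lin (\<lambda>q. ?F p q r s)"
      "lin (\<lambda>r. ?F p q r s)" "lin (\<lambda>s. ?F p q r s)" for p q r s
    by (intro lin_functional_scale lin_scale_const lin_id functional_counit f_lin)+
  have left: "(\<Sum>(s, t)\<leftarrow>braiding \<Delta> dot col u1 v2. \<Sum>(s', t')\<leftarrow>braiding \<Delta> dot col u2 v1. ?F s t s' t')
      = f (u1 \<cdot> v2) (u2 \<cdot> v1)" for u1 u2 v1 v2
  proof -
    have "(\<Sum>(s', t')\<leftarrow>braiding \<Delta> dot col u2 v1. \<epsilon> s *s (\<epsilon> s' *s f t t')) = \<epsilon> s *s f t (u2 \<cdot> v1)" for s t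
      using sum_braiding_counit_left[OF f_lin(2)[of t], of u2 v1]
      by (simp add: case_prod_unfold sum_list_scale del: scale_scale)
    then show ?thesis
      by (simp add: sum_braiding_counit_left[OF f_lin(1)])
  qed
  have right: "sweedler (\<lambda>s1 s2. sweedler (\<lambda>t1 t2. ?F s2 t1 s1 t2) t) s = \<epsilon> s *s sweedler f t" for s t
  proof -
    have "sweedler (\<lambda>t1 t2. \<epsilon> s2 *s (\<epsilon> s1 *s f t1 t2)) t = \<epsilon> s2 *s (\<epsilon> s1 *s sweedler f t)" for s1 s2
      using lin_sweedler_commute[of "\<lambda>u. \<epsilon> s2 *s (\<epsilon> s1 *s u)" f t]
      by (simp add: lin_scale_const lin_id del: scale_scale)
    then show ?thesis
      using sweedler_counit_right[of "\<lambda>s. \<epsilon> s *s sweedler f t" s]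
      by (simp add: lin_functional functional_counit del: scale_scale)
  qed
  show ?thesis
    using braiding_comult_quad[of ?F, OF lin_F, where u = u and v = v, unfolded left right]
      sum_braiding_counit_left[OF lin_sweedler[OF f]]
    by simp
qed

lemma comult_col:
  assumes f: "bilin f"
  shows "sweedler f (v \<Colon> u) = sweedler (\<lambda>v1 v2. sweedler (\<lambda>u1 u2. f (v1 \<Colon> u2) (v2 \<Colon> u1)) u) v"
proof -
  note f_lin = f[unfolded bilin_def, THEN conjunct1, rule_format]
    f[unfolded bilin_def, THEN conjunct2, rule_format]
  let ?F = "\<lambda>p q r s. \<epsilon> q *s (\<epsilon> s *s f r p)"
  have lin_F: "lin (\<lambda>p. ?F p q r s)" "lin (\<lambda>q. ?F p q r s)"
      "lin (\<lambda>r. ?F p q r s)" "lin (\<lambda>s. ?F p q r s)" for p q r s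
    by (intro lin_functional_scale lin_scale_const lin_id functional_counit f_lin)+
  have left: "(\<Sum>(s, t)\<leftarrow>braiding \<Delta> dot col u1 v2. \<Sum>(s', t')\<leftarrow>braiding \<Delta> dot col u2 v1. ?F s t s' t')
      = f (v1 \<Colon> u2) (v2 \<Colon> u1)" for u1 u2 v1 v2
  proof -
    have "(\<Sum>(s', t')\<leftarrow>braiding \<Delta> dot col u2 v1. \<epsilon> t *s (\<epsilon> t' *s f s' s)) = \<epsilon> t *s f (v1 \<Colon> u2) s" for s t
      using sum_braiding_counit_right[OF f_lin(1)[of s], of u2 v1]
      by (simp add: case_prod_unfold sum_list_scale del: scale_scale)
    then show ?thesis
      by (simp add: sum_braiding_counit_right[OF f_lin(2)])
  qed
  have right: "sweedler (\<lambda>s1 s2. sweedler (\<lambda>t1 t2. ?F s2 t1 s1 t2) t) s = \<epsilon> t *s sweedler f s" for s t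
  proof -
    have "sweedler (\<lambda>t1 t2. \<epsilon> t1 *s (\<epsilon> t2 *s w)) t = \<epsilon> t *s w" for w
      using sweedler_counit_left[of "\<lambda>t. \<epsilon> t *s w" t]
      by (simp add: lin_functional functional_counit del: scale_scale)
    then show ?thesis
      using lin_sweedler_commute[of "\<lambda>u. \<epsilon> t *s u" f s] by (simp add: lin_scale_const lin_id)
  qed
  show ?thesis
    using braiding_comult_quad[of ?F, OF lin_F, where u = u and v = v, unfolded left right]
      sum_braiding_counit_right[OF lin_sweedler[OF f]]
    by (simp add: sweedler_swap[of _ v u])
qed

lemma braiding_cocommutative:
  assumes f: "bilin f"
  shows "sweedler (\<lambda>u1 u2. sweedler (\<lambda>v1 v2. f (v1 \<Colon> u2) (u1 \<cdot> v2)) v) u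
    = sweedler (\<lambda>u1 u2. sweedler (\<lambda>v1 v2. f (v2 \<Colon> u1) (u2 \<cdot> v1)) v) u"
proof -
  note f_lin = f[unfolded bilin_def, THEN conjunct1, rule_format]
    f[unfolded bilin_def, THEN conjunct2, rule_format]
  let ?F = "\<lambda>p q r s. \<epsilon> q *s (\<epsilon> r *s f p s)"
  have lin_F: "lin (\<lambda>p. ?F p q r s)" "lin (\<lambda>q. ?F p q r s)"
      "lin (\<lambda>r. ?F p q r s)" "lin (\<lambda>s. ?F p q r s)" for p q r s
    by (intro lin_functional_scale lin_scale_const lin_id functional_counit f_lin)+
  have left: "(\<Sum>(s, t)\<leftarrow>braiding \<Delta> dot col u1 v2. \<Sum>(s', t')\<leftarrow>braiding \<Delta> dot col u2 v1. ?F s t s' t')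
      = f (v2 \<Colon> u1) (u2 \<cdot> v1)" for u1 u2 v1 v2
  proof -
    have "(\<Sum>(s', t')\<leftarrow>braiding \<Delta> dot col u2 v1. \<epsilon> t *s (\<epsilon> s' *s f s t')) = \<epsilon> t *s f s (u2 \<cdot> v1)" for s t
      using sum_braiding_counit_left[OF f_lin(2)[of s], of u2 v1]
      by (simp add: case_prod_unfold sum_list_scale del: scale_scale)
    then show ?thesis
      by (simp add: sum_braiding_counit_right[OF f_lin(1)])
  qed
  have right: "sweedler (\<lambda>s1 s2. sweedler (\<lambda>t1 t2. ?F s2 t1 s1 t2) t) s = f s t" for s t
  proof -
    have "sweedler (\<lambda>t1 t2. \<epsilon> t1 *s (\<epsilon> s1 *s f s2 t2)) t = \<epsilon> s1 *s f s2 t" for s1 s2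
      using sweedler_counit_left[of "\<lambda>t. \<epsilon> s1 *s f s2 t" t]
      by (simp add: lin_scale_const f_lin del: scale_scale)
    then show ?thesis
      using sweedler_counit_left[of "\<lambda>s. f s t" s] by (simp add: f_lin del: scale_scale)
  qed
  show ?thesis
    using braiding_comult_quad[of ?F, OF lin_F, where u = u and v = v, unfolded left right]
    by (simp add: sum_braiding)
qed

end

section \<open>Group elements and the generator \<open>x\<close> in a Hopf \<open>q\<close>-brace\<close>

text \<open>The coalgebra conditions appear in the form derived in the previous section. They and the
  module and product axioms are invariant under exchanging \<open>\<cdot>\<close> with \<open>\<Colon>\<close>, so every statement
  about \<open>\<cdot>\<close> transfers to \<open>\<Colon>\<close>.\<close>

locale rank_one_brace = rank_one scale \<Delta> \<epsilon> G \<chi> a \<alpha> \<iota> x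
  for scale :: "'k::field \<Rightarrow> 'h::ring_1 \<Rightarrow> 'h" (infixr "*s" 75)
    and \<Delta> :: "'h \<Rightarrow> ('h \<times> 'h) list"
    and \<epsilon> :: "'h \<Rightarrow> 'k"
    and G :: "('g, 'b) monoid_scheme"
    and \<chi> :: "'g \<Rightarrow> 'k" and a :: 'g and \<alpha> :: 'k
    and \<iota> :: "'g \<Rightarrow> 'h" and x :: 'h +
  fixes dot :: "'h \<Rightarrow> 'h \<Rightarrow> 'h" (infixl "\<cdot>" 68)
    and col :: "'h \<Rightarrow> 'h \<Rightarrow> 'h" (infixl "\<Colon>" 68)
  assumes dot_left: "lin \<phi> \<Longrightarrow> lin (\<lambda>u. \<phi> u \<cdot> v)"
    and dot_right: "lin \<phi> \<Longrightarrow> lin (\<lambda>v. u \<cdot> \<phi> v)"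
    and col_left: "lin \<phi> \<Longrightarrow> lin (\<lambda>u. \<phi> u \<Colon> v)"
    and col_right: "lin \<phi> \<Longrightarrow> lin (\<lambda>v. u \<Colon> \<phi> v)"
    and dot_counit: "\<epsilon> (u \<cdot> v) = \<epsilon> u * \<epsilon> v"
    and col_counit: "\<epsilon> (u \<Colon> v) = \<epsilon> u * \<epsilon> v"
    and dot_comult: "bilin f \<Longrightarrow>
      sweedler f (u \<cdot> v) = sweedler (\<lambda>u1 u2. sweedler (\<lambda>v1 v2. f (u1 \<cdot> v2) (u2 \<cdot> v1)) v) u"
    and col_comult: "bilin f \<Longrightarrow>
      sweedler f (u \<Colon> v) = sweedler (\<lambda>u1 u2. sweedler (\<lambda>v1 v2. f (u1 \<Colon> v2) (u2 \<Colon> v1)) v) u"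
    and cocommutative: "bilin f \<Longrightarrow>
      sweedler (\<lambda>u1 u2. sweedler (\<lambda>v1 v2. f (v1 \<Colon> u2) (u1 \<cdot> v2)) v) u
        = sweedler (\<lambda>u1 u2. sweedler (\<lambda>v1 v2. f (v2 \<Colon> u1) (u2 \<cdot> v1)) v) u"
    and dot_unit: "h \<cdot> 1 = h"
    and col_unit: "h \<Colon> 1 = h"
    and dot_times: "h \<cdot> k * l = (h \<cdot> l) \<cdot> k"
    and col_times: "h \<Colon> k * l = (h \<Colon> l) \<Colon> k"
    and times_dot: "h * k \<cdot> l =
      sweedler (\<lambda>k1 k2. sweedler (\<lambda>l1 l2. (h \<cdot> (l1 \<Colon> k2)) * (k1 \<cdot> l2)) l) k"
    and times_col: "h * k \<Colon> l =
      sweedler (\<lambda>k1 k2. sweedler (\<lambda>l1 l2. (h \<Colon> (l1 \<cdot> k2)) * (k1 \<Colon> l2)) l) k"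
begin

lemma swapped: "rank_one_brace scale \<Delta> \<epsilon> G \<chi> a \<alpha> \<iota> x col dot"
proof (intro rank_one_brace.intro rank_one_brace_axioms.intro)
  fix f u v assume f: "bilin f"
  have "bilin (\<lambda>p q. f q p)" using f by (simp add: bilin_def)
  from cocommutative[OF this, of u v]
  show "sweedler (\<lambda>u1 u2. sweedler (\<lambda>v1 v2. f (v1 \<cdot> u2) (u1 \<Colon> v2)) v) u
      = sweedler (\<lambda>u1 u2. sweedler (\<lambda>v1 v2. f (v2 \<cdot> u1) (u2 \<Colon> v1)) v) u"
    by (subst (1 2) sweedler_swap) simp
qed (fact rank_one_axioms dot_left dot_right col_left col_right dot_counit col_counit dot_comult col_comult
    dot_unit col_unit dot_times col_times times_dot times_col)+

lemmas dot_simps = lin_add[OF dot_left[OF lin_id]] lin_add[OF dot_right[OF lin_id]]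
  lin_scale[OF dot_left[OF lin_id]] lin_scale[OF dot_right[OF lin_id]]
  lin_diff[OF dot_left[OF lin_id]] lin_diff[OF dot_right[OF lin_id]]
  lin_0[OF dot_left[OF lin_id]] lin_0[OF dot_right[OF lin_id]]

lemmas lin_intros = lin_id lin_mult_left lin_mult_right dot_left dot_right col_left col_right
  lin_sweedler_param lin_scale_const lin_plus

lemmas bilin_simps = bilinI lin_intros

lemma times_dot_group_group:
  "g \<in> carrier G \<Longrightarrow> k \<in> carrier G \<Longrightarrow>
    h * \<iota> k \<cdot> \<iota> g = (h \<cdot> (\<iota> g \<Colon> \<iota> k)) * (\<iota> k \<cdot> \<iota> g)"
  by (simp add: times_dot sweedler_iota bilin_simps)

lemma times_dot_x_group:
  "g \<in> carrier G \<Longrightarrow>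
    h * x \<cdot> \<iota> g = (h \<cdot> (\<iota> g \<Colon> \<iota> a)) * (x \<cdot> \<iota> g) + (h \<cdot> (\<iota> g \<Colon> x)) * (1 \<cdot> \<iota> g)"
  by (simp add: times_dot sweedler_iota sweedler_x bilin_simps)

lemma times_dot_group_x:
  "k \<in> carrier G \<Longrightarrow>
    h * \<iota> k \<cdot> x = (h \<cdot> (x \<Colon> \<iota> k)) * (\<iota> k \<cdot> \<iota> a) + (h \<cdot> (1 \<Colon> \<iota> k)) * (\<iota> k \<cdot> x)"
  by (simp add: times_dot sweedler_iota sweedler_x bilin_simps)

lemma group_dot_group:
  assumes "g \<in> carrier G" "h \<in> carrier G"
  obtains k where "k \<in> carrier G" "\<iota> g \<cdot> \<iota> h = \<iota> k"
proof -
  have "sweedler f (\<iota> g \<cdot> \<iota> h) = f (\<iota> g \<cdot> \<iota> h) (\<iota> g \<cdot> \<iota> h)" if f: "bilin f" for f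
    using assms by (simp add: f dot_comult sweedler_iota bilin_simps bilin_lin[OF f])
  then have "grouplike (\<iota> g \<cdot> \<iota> h)"
    using assms by (simp add: grouplike_def dot_counit counit_iota)
  then show thesis using that by (rule grouplike_imp_iota)
qed

lemma dot_inverse: "g \<in> carrier G \<Longrightarrow> (u \<cdot> \<iota> g) \<cdot> \<iota> (inv\<^bsub>G\<^esub> g) = u"
  by (simp add: iota_mult dot_unit flip: dot_times)

text \<open>By the product axiom \<open>1 \<cdot> g\<close> is idempotent, and it is a group element.\<close>

lemma one_dot_group: "g \<in> carrier G \<Longrightarrow> 1 \<cdot> \<iota> g = 1"
proof -
  assume g: "g \<in> carrier G"
  obtain k where k: "k \<in> carrier G" "1 \<cdot> \<iota> g = \<iota> k"
    using group_dot_group[OF Gr.one_closed g] by (metis iota_one)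
  have "1 \<cdot> \<iota> g = (1 \<cdot> \<iota> g) * (1 \<cdot> \<iota> g)"
    using times_dot_group_group[OF g Gr.one_closed, of 1] by (simp add: col_unit)
  then have "k = k \<otimes>\<^bsub>G\<^esub> k"
    using k by (simp add: iota_mult iota_eq_iff)
  then have "k = \<one>\<^bsub>G\<^esub>" using k(1) by (metis Gr.l_cancel_one')
  then show ?thesis using k by simp
qed

lemma one_dot_x: "1 \<cdot> x = 0"
  using times_dot_group_x[OF Gr.one_closed, of 1] by (simp add: col_unit dot_unit one_dot_group)

text \<open>The element \<open>x \<cdot> g\<close> is \<open>(1, a \<cdot> g)\<close>-skew-primitive. It is not a multiple of \<open>1 - a \<cdot> g\<close>: that
  one is the image of \<open>1 - a\<close>, and acting by \<open>g\<close> is injective. The classification of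
  skew-primitive elements then forces \<open>a \<cdot> g = a\<close>.\<close>

lemma x_dot_group_cases:
  assumes g: "g \<in> carrier G"
  shows "\<iota> a \<cdot> \<iota> g = \<iota> a" "\<exists>c d. c \<noteq> 0 \<and> x \<cdot> \<iota> g = c *s x + d *s (1 - \<iota> a)"
proof -
  obtain h where h: "h \<in> carrier G" "\<iota> a \<cdot> \<iota> g = \<iota> h"
    using group_dot_group[OF a_carrier g] .
  have "skew_primitive (\<iota> h) (x \<cdot> \<iota> g)"
    unfolding skew_primitive_def
  proof (intro allI impI)
    fix f assume f: "bilin f"
    show "sweedler f (x \<cdot> \<iota> g) = f (x \<cdot> \<iota> g) (\<iota> h) + f 1 (x \<cdot> \<iota> g)"
      using g h by (simp add: f dot_comult sweedler_iota sweedler_x one_dot_group bilin_simps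
          bilin_lin[OF f])
  qed
  then have "h = a \<and> (\<exists>c d. c \<noteq> 0 \<and> x \<cdot> \<iota> g = c *s x + d *s (1 - \<iota> a))"
    using h(1)
  proof (cases rule: skew_primitive_cases)
    case (trivial d)
    have "x = (d *s (1 - \<iota> a \<cdot> \<iota> g)) \<cdot> \<iota> (inv\<^bsub>G\<^esub> g)"
      using dot_inverse[OF g, of x] trivial h by simp
    also have "\<dots> = d *s (1 - \<iota> a)"
      using g by (simp add: dot_simps one_dot_group dot_inverse)
    finally have "coef \<one>\<^bsub>G\<^esub> 1 x = coef \<one>\<^bsub>G\<^esub> 1 (d *s (\<iota> \<one>\<^bsub>G\<^esub> - \<iota> a))" by simp
    then show ?thesis using n_gt_1 by (simp add: coef_simps coef_x coef_iota del: iota_one)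
  next
    case (nontrivial c d)
    then show ?thesis by blast
  qed
  then show "\<iota> a \<cdot> \<iota> g = \<iota> a" "\<exists>c d. c \<noteq> 0 \<and> x \<cdot> \<iota> g = c *s x + d *s (1 - \<iota> a)"
    using h by simp_all
qed

text \<open>Cocommutativity of the braiding at \<open>x\<close> and \<open>g\<close> reads
  \<open>(g \<Colon> a - g) \<otimes> (x \<cdot> g) = (g \<Colon> x) \<otimes> (a - 1)\<close>. Since \<open>x \<cdot> g\<close> and \<open>a - 1\<close> are linearly independent, both
  sides vanish. The coefficients at \<open>x\<close> and at \<open>a\<close> serve as the two test forms.\<close>

lemma group_col_a_and_x:
  assumes g: "g \<in> carrier G"
  shows "\<iota> g \<Colon> \<iota> a = \<iota> g" "\<iota> g \<Colon> x = 0"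
proof -
  obtain c d where cd: "c \<noteq> 0" "x \<cdot> \<iota> g = c *s x + d *s (1 - \<iota> a)"
    using x_dot_group_cases(2)[OF g] by blast
  have eq: "f (\<iota> g \<Colon> \<iota> a) (x \<cdot> \<iota> g) + f (\<iota> g \<Colon> x) 1 = f (\<iota> g \<Colon> x) (\<iota> a) + f (\<iota> g) (x \<cdot> \<iota> g)"
    if f: "bilin f" for f
    using cocommutative[OF f, of "\<iota> g" x] g
    by (simp add: sweedler_iota sweedler_x one_dot_group x_dot_group_cases(1) col_unit bilin_simps
        bilin_lin[OF f])
  have "c *s (\<iota> g \<Colon> \<iota> a) = c *s \<iota> g"
    using eq[OF bilin_slice_right[OF functional_coef[of "\<one>\<^bsub>G\<^esub>" 1]]] n_gt_1
    by (simp add: cd(2) coef_simps coef_x coef_one coef_iota)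
  then show ga: "\<iota> g \<Colon> \<iota> a = \<iota> g" using cd(1) by simp
  show "\<iota> g \<Colon> x = 0"
    using eq[OF bilin_slice_right[OF functional_coef[of a 0]]] n_gt_1 a_not_one
    by (simp add: cd(2) coef_simps coef_x coef_one coef_iota ga)
qed

lemma group_dot_a: "g \<in> carrier G \<Longrightarrow> \<iota> g \<cdot> \<iota> a = \<iota> g"
  and group_dot_x: "g \<in> carrier G \<Longrightarrow> \<iota> g \<cdot> x = 0"
  by (rule rank_one_brace.group_col_a_and_x[OF swapped]; assumption)+

definition lam :: "'g \<Rightarrow> 'k" where "lam g = coef \<one>\<^bsub>G\<^esub> 1 (x \<cdot> \<iota> g)"

text \<open>Acting by \<open>g\<close> on both sides of \<open>x a = \<chi>(a) a x\<close> gives \<open>(x \<cdot> g) a = \<chi>(a) a (x \<cdot> g)\<close>. The component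
  of \<open>x \<cdot> g\<close> along \<open>1 - a\<close> commutes with \<open>a\<close>, so it vanishes because \<open>\<chi>(a) \<noteq> 1\<close>.\<close>

lemma x_dot_group:
  assumes g: "g \<in> carrier G"
  shows "x \<cdot> \<iota> g = lam g *s x" "lam g \<noteq> 0"
proof -
  obtain c d where cd: "c \<noteq> 0" "x \<cdot> \<iota> g = c *s x + d *s (1 - \<iota> a)"
    using x_dot_group_cases(2)[OF g] by blast
  have "(x \<cdot> \<iota> g) * \<iota> a = x * \<iota> a \<cdot> \<iota> g"
    using times_dot_group_group[OF g a_carrier, of x]
    by (simp add: group_col_a_and_x(1)[OF g] x_dot_group_cases(1)[OF g])
  also have "\<dots> = \<chi> a *s (\<iota> a * (x \<cdot> \<iota> g))"
    using times_dot_x_group[OF g, of "\<iota> a"]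
    by (simp add: x_iota dot_simps group_col_a_and_x[OF g] x_dot_group_cases(1)[OF g])
  finally have "coef a 0 ((x \<cdot> \<iota> g) * \<iota> a) = \<chi> a * coef a 0 (\<iota> a * (x \<cdot> \<iota> g))"
    by (simp add: coef_simps)
  moreover have "coef a 0 (\<iota> a * x) = 0" "a \<noteq> a \<otimes>\<^bsub>G\<^esub> a"
    using coef_monomial[of a a 0 1] n_gt_1 a_not_one Gr.l_cancel_one'[of a a] by auto
  ultimately have "d = \<chi> a * d"
    using n_gt_1
    by (simp add: cd(2) distrib_left distrib_right left_diff_distrib right_diff_distrib
        scale_mult_left scale_mult_right x_iota iota_mult coef_simps coef_iota)
  then have "d = 0" using chi_a_power_less[of 1] n_gt_1 by simp
  then have "x \<cdot> \<iota> g = c *s x" "lam g = c"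
    using n_gt_1 by (simp_all add: cd(2) lam_def coef_simps coef_x)
  then show "x \<cdot> \<iota> g = lam g *s x" "lam g \<noteq> 0" using cd(1) by simp_all
qed

lemma times_x_dot_group: "g \<in> carrier G \<Longrightarrow> u * x \<cdot> \<iota> g = lam g *s ((u \<cdot> \<iota> g) * x)"
  by (simp add: times_dot_x_group group_col_a_and_x x_dot_group dot_simps scale_mult_right)

lemma monomial_dot_group:
  "g \<in> carrier G \<Longrightarrow> u * x ^ r \<cdot> \<iota> g = lam g ^ r *s ((u \<cdot> \<iota> g) * x ^ r)"
proof (induction r)
  case (Suc r)
  have "u * x ^ Suc r \<cdot> \<iota> g = lam g *s ((u * x ^ r \<cdot> \<iota> g) * x)"
    using times_x_dot_group[OF Suc.prems, of "u * x ^ r"]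
    by (simp add: mult.assoc power_Suc2 del: power_Suc)
  also have "\<dots> = lam g ^ Suc r *s ((u \<cdot> \<iota> g) * x ^ Suc r)"
    using Suc by (simp add: scale_mult_left mult.assoc power_Suc2 del: power_Suc)
  finally show ?case .
qed simp

text \<open>As \<open>a \<cdot> x = 0\<close>, the element \<open>x \<cdot> x\<close> is \<open>(1, a)\<close>-skew-primitive. Its component along \<open>x\<close> is
  excluded by letting both sides of \<open>x a = \<chi>(a) a x\<close> act on \<open>x\<close>: up to the nonzero scalar by which
  \<open>a\<close> acts on \<open>x\<close>, that component is equal to \<open>\<chi>(a)\<close> times itself.\<close>

lemma x_dot_x: "x \<cdot> x = coef \<one>\<^bsub>G\<^esub> 0 (x \<cdot> x) *s (1 - \<iota> a)"
proof -
  have a_simps: "\<iota> a \<cdot> x = 0" "\<iota> a \<cdot> 1 = \<iota> a" "1 \<cdot> \<iota> a = 1" "1 \<cdot> x = 0"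
    by (simp_all add: group_dot_x dot_unit one_dot_group one_dot_x)
  have "skew_primitive (\<iota> a) (x \<cdot> x)"
    unfolding skew_primitive_def
  proof (intro allI impI)
    fix f assume f: "bilin f"
    then have "f u 0 = 0" "f 0 u = 0" for u
      using lin_0[of "\<lambda>v. f v u"] lin_0[of "f u"] by (simp_all add: bilin_def)
    then show "sweedler f (x \<cdot> x) = f (x \<cdot> x) (\<iota> a) + f 1 (x \<cdot> x)"
      by (simp add: f dot_comult sweedler_x a_simps bilin_simps bilin_lin[OF f])
  qed
  then show ?thesis
    using a_carrier
  proof (cases rule: skew_primitive_cases)
    case (trivial d)
    then show ?thesis using n_gt_1 a_not_one by (simp add: coef_simps coef_one coef_iota)
  next
    case (nontrivial c d)
    have "lam a *s (x \<cdot> x) = x \<cdot> x * \<iota> a"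
      by (simp add: dot_times x_dot_group dot_simps)
    also have "\<dots> = \<chi> a *s ((x \<cdot> x) \<cdot> \<iota> a)"
      by (simp add: x_iota dot_simps dot_times)
    finally have "coef \<one>\<^bsub>G\<^esub> 1 (lam a *s (x \<cdot> x)) = coef \<one>\<^bsub>G\<^esub> 1 (\<chi> a *s ((x \<cdot> x) \<cdot> \<iota> a))"
      by simp
    then have "lam a * c = \<chi> a * (c * lam a)"
      using n_gt_1 by (simp add: nontrivial(3) dot_simps x_dot_group one_dot_group group_dot_a
          coef_simps coef_x coef_one coef_iota)
    then show ?thesis
      using nontrivial(2) x_dot_group(2)[OF a_carrier] chi_a_power_less[of 1] n_gt_1 by simp
  qed
qed

lemma a_power_dot_group: "g \<in> carrier G \<Longrightarrow> \<iota> a ^ r \<cdot> \<iota> g = \<iota> a ^ r"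
proof (induction r)
  case (Suc r)
  then show ?case
    using times_dot_group_group[OF Suc.prems a_carrier, of "\<iota> a ^ r"]
    by (simp add: group_col_a_and_x x_dot_group_cases(1) power_Suc2 del: power_Suc)
qed (simp add: one_dot_group)

lemma group_dot_monomial:
  assumes "g \<in> carrier G" "r \<ge> 1"
  shows "\<iota> g \<cdot> u * x ^ r = 0"
proof -
  obtain s where "r = Suc s" using assms(2) by (cases r) auto
  then have "\<iota> g \<cdot> u * x ^ r = ((\<iota> g \<cdot> x) \<cdot> x ^ s) \<cdot> u"
    by (simp add: dot_times power_Suc2 del: power_Suc)
  then show ?thesis using assms by (simp add: group_dot_x dot_simps)
qed

lemma group_dot_a_power: "g \<in> carrier G \<Longrightarrow> \<iota> g \<cdot> \<iota> a ^ r = \<iota> g"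
  by (induction r) (simp_all add: dot_unit dot_times group_dot_a power_Suc2 del: power_Suc)

lemma x_dot_a_power: "x \<cdot> \<iota> a ^ r = lam a ^ r *s x"
  by (induction r) (simp_all add: dot_unit dot_times x_dot_group dot_simps power_Suc2 del: power_Suc)

text \<open>The element \<open>x \<cdot> x\<close> is a multiple of \<open>1 - a\<close>, which \<open>x\<close> annihilates, so \<open>x \<cdot> x\<^sup>n = 0\<close> as
  \<open>n \<ge> 2\<close>. On the other hand \<open>x\<^sup>n = \<alpha> (a\<^sup>n - 1)\<close> acts on \<open>x\<close> by the scalar \<open>\<alpha> (\<lambda>\<^sup>n - 1)\<close>, where
  \<open>\<lambda>\<close> is the eigenvalue of \<open>a\<close>.\<close>

lemma alpha_lam: "\<alpha> * (lam a ^ n - 1) = 0"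
proof -
  have "n = Suc (Suc (n - 2))" using n_gt_1 by simp
  then have "x ^ n = x ^ (n - 2) * x * x" by (metis power_Suc2)
  then have "x \<cdot> x ^ n = ((x \<cdot> x) \<cdot> x) \<cdot> x ^ (n - 2)"
    by (simp only: dot_times)
  also have "(x \<cdot> x) \<cdot> x = 0"
    by (subst x_dot_x) (simp add: dot_simps one_dot_x group_dot_x)
  finally have "(\<alpha> * (lam a ^ n - 1)) *s x = 0"
    by (simp add: x_power_n dot_simps x_dot_a_power dot_unit right_diff_distrib scale_left_diff_distrib
        scale_right_diff_distrib)
  moreover have "x \<noteq> 0"
    using deg1_x deg1_simps(1) by (metis zero_neq_one)
  ultimately show ?thesis by simp
qed

text \<open>By \<open>alpha_lam\<close> either \<open>\<alpha> = 0\<close> or \<open>a\<^sup>n\<close> acts as the identity on every monomial.\<close>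

lemma monomial_dot_x_power_n:
  assumes "h \<in> carrier G" "g \<in> carrier G"
  shows "\<iota> h * x ^ r \<cdot> \<alpha> *s (\<iota> g * (\<iota> a ^ n - 1)) = 0"
proof -
  have "\<iota> h * x ^ r \<cdot> \<iota> a ^ m = lam a ^ (m * r) *s (\<iota> h * x ^ r)" for m
  proof (induction m)
    case (Suc m)
    then show ?case
      using monomial_dot_group[OF a_carrier, of "\<iota> h" r] assms(1)
      by (simp add: dot_times dot_simps group_dot_a power_add)
  qed (simp add: dot_unit)
  from this[of n] have "\<iota> h * x ^ r \<cdot> \<iota> a ^ n = (lam a ^ n) ^ r *s (\<iota> h * x ^ r)"
    by (simp add: power_mult)
  then have "\<iota> h * x ^ r \<cdot> \<alpha> *s (\<iota> g * (\<iota> a ^ n - 1))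
      = \<alpha> *s (((lam a ^ n) ^ r *s (\<iota> h * x ^ r)) \<cdot> \<iota> g - \<iota> h * x ^ r \<cdot> \<iota> g)"
    by (simp only: dot_simps dot_times right_diff_distrib mult_1_right)
  moreover have "\<alpha> = 0 \<or> lam a ^ n = 1" using alpha_lam by simp
  ultimately show ?thesis by auto
qed

end

section \<open>Hopf \<open>q\<close>-braces on rank one pointed Hopf algebras\<close>

theorem proposition2p8:
  fixes scale :: "'k::{alg_closed_field, field_char_0} \<Rightarrow> 'h::ring_1 \<Rightarrow> 'h" (infixr "*s" 75)
    and \<Delta> :: "'h \<Rightarrow> ('h \<times> 'h) list" and \<epsilon> :: "'h \<Rightarrow> 'k"
    and G :: "('g, 'b) monoid_scheme"
    and \<chi> :: "'g \<Rightarrow> 'k" and a :: 'g and \<alpha> :: 'k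
    and \<iota> :: "'g \<Rightarrow> 'h" and x :: 'h
    and dot :: "'h \<Rightarrow> 'h \<Rightarrow> 'h" (infixl "\<cdot>" 68)
    and col :: "'h \<Rightarrow> 'h \<Rightarrow> 'h" (infixl "\<Colon>" 68)
    and n :: nat
    and coeff :: "'h \<Rightarrow> 'h \<Rightarrow> 'k"
    and lambda10 xi10 :: 'k and lambda11 xi11 :: "'g \<Rightarrow> 'k"
  assumes H: "rank_one_pointed_hopf_algebra scale \<Delta> \<epsilon> G \<chi> a \<alpha> \<iota> x"
    and brace: "hopf_q_brace scale \<Delta> \<epsilon> dot col"
  defines "n \<equiv> mult_order (\<chi> a)"
    and "coeff \<equiv> module.representation scale (monomials G n \<iota> x)"
    and "lambda10 \<equiv> coeff (x \<cdot> x) 1"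
    and "xi10 \<equiv> coeff (x \<Colon> x) 1"
    and "lambda11 \<equiv> (\<lambda>g. coeff (x \<cdot> \<iota> g) x)"
    and "xi11 \<equiv> (\<lambda>g. coeff (x \<Colon> \<iota> g) x)"
  shows "(x \<cdot> x = lambda10 *s (1 - \<iota> a) \<and> x \<Colon> x = xi10 *s (1 - \<iota> a)) \<and>
    (\<forall>g\<in>carrier G. \<forall>r. \<iota> a ^ r \<cdot> \<iota> g = \<iota> a ^ r \<and> \<iota> a ^ r \<Colon> \<iota> g = \<iota> a ^ r) \<and>
    (\<forall>h\<in>carrier G. \<forall>g\<in>carrier G. \<forall>r\<ge>1.
       \<iota> g \<cdot> \<iota> h * x ^ r = 0 \<and> \<iota> g \<Colon> \<iota> h * x ^ r = 0) \<and>
    (\<forall>g\<in>carrier G. \<forall>r. \<iota> g \<cdot> \<iota> a ^ r = \<iota> g \<and> \<iota> g \<Colon> \<iota> a ^ r = \<iota> g) \<and>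
    (\<forall>h\<in>carrier G. \<forall>g\<in>carrier G. \<forall>r\<ge>1.
       \<iota> h * x ^ r \<cdot> \<iota> g = lambda11 g ^ r *s ((\<iota> h \<cdot> \<iota> g) * x ^ r) \<and>
       \<iota> h * x ^ r \<Colon> \<iota> g = xi11 g ^ r *s ((\<iota> h \<Colon> \<iota> g) * x ^ r)) \<and>
    (\<forall>h\<in>carrier G. \<forall>g\<in>carrier G. \<forall>r<n.
       \<iota> h * x ^ r \<cdot> \<alpha> *s (\<iota> g * (\<iota> a ^ n - 1)) = 0 \<and>
       \<iota> h * x ^ r \<Colon> \<alpha> *s (\<iota> g * (\<iota> a ^ n - 1)) = 0)"
proof -
  interpret H: rank_one scale \<Delta> \<epsilon> G \<chi> a \<alpha> \<iota> x
    by (rule rank_one.intro[OF H])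
  interpret q: hopf_q_brace scale \<Delta> \<epsilon> dot col by (rule brace)
  have dot_col: "rank_one_brace scale \<Delta> \<epsilon> G \<chi> a \<alpha> \<iota> x dot col"
    by (intro rank_one_brace.intro rank_one_brace_axioms.intro)
      (fact H.rank_one_axioms q.lin_dot_left q.lin_dot_right q.lin_col_left q.lin_col_right q.counit_dot q.counit_col
        q.comult_dot q.comult_col q.braiding_cocommutative q.dot_one q.col_one q.dot_mult q.col_mult
        q.mult_dot[folded H.sweedler_def] q.mult_col[folded H.sweedler_def])+
  interpret d: rank_one_brace scale \<Delta> \<epsilon> G \<chi> a \<alpha> \<iota> x dot col by (rule dot_col)
  interpret c: rank_one_brace scale \<Delta> \<epsilon> G \<chi> a \<alpha> \<iota> x col dot by (rule d.swapped)
  have n: "n = H.n" by (simp add: n_def H.n_def)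
  have coeff: "coeff u (\<iota> g * x ^ m) = H.coef g m u" for u g m
    by (simp add: coeff_def H.coef_def n)
  have coeffs: "lambda10 = H.coef \<one>\<^bsub>G\<^esub> 0 (x \<cdot> x)" "xi10 = H.coef \<one>\<^bsub>G\<^esub> 0 (x \<Colon> x)"
      "lambda11 g = d.lam g" "xi11 g = c.lam g" for g
    using coeff[of _ "\<one>\<^bsub>G\<^esub>" 0] coeff[of _ "\<one>\<^bsub>G\<^esub>" 1]
    by (simp_all add: lambda10_def xi10_def lambda11_def xi11_def d.lam_def c.lam_def)
  show ?thesis
    unfolding coeffs n
    by (intro conjI ballI allI impI)
      (assumption | rule d.x_dot_x c.x_dot_x d.a_power_dot_group c.a_power_dot_group
        d.group_dot_monomial c.group_dot_monomial d.group_dot_a_power c.group_dot_a_power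
        d.monomial_dot_group c.monomial_dot_group d.monomial_dot_x_power_n
        c.monomial_dot_x_power_n)+
qed

end
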